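(* Let $d\ge 1$ and suppose that the graph $G$ is $(d+1)$-connected but not generically globally rigid in $\mathbb{R}^d$. Then $\operatorname{stressedCorank}(G)>\operatorname{corank}(G)$.
   Context: Graphs are finite and simple, with vertex set $\{1,\dots,n\}$ and $m$ edges. A graph is $k$-connected if it has at least $k+1$ vertices and remains connected after deleting any set of fewer than $k$ vertices. A framework $(G,p)$ in $\mathbb{R}^d$ is $G$ with a configuration $p=(p_1,\dots,p_n)$ of points of $\mathbb{R}^d$. Frameworks $(G,p)$ and $(G,q)$ in $\mathbb{R}^d$ are equivalent if $\|p_i-p_j\|=\|q_i-q_j\|$ for all edges $\{i,j\}$, and congruent if $q_i=T(p_i)$ for all $i$ for some Euclidean motion $T$ of $\mathbb{R}^d$. $(G,p)$ is globally rigid if every $(G,q)$ in $\mathbb{R}^d$ equivalent to it is congruent to it. A configuration is generic if its coordinates are algebraically independent over $\mathbb{Q}$. $G$ is generically globally rigid in $\mathbb{R}^d$ if every generic framework $(G,p)$ in $\mathbb{R}^d$ is globally rigid (it is known that otherwise no generic framework is). The rigidity matrix $R(p)$ is the $m\times dn$ matrix of the linear system $\langle p_j-p_i,\,p'_j-p'_i\rangle=0$ (one equation per edge $\{i,j\}$) in the unknowns $p'\in(\mathbb{R}^d)^n$. $\operatorname{corank}(G,p)$ is the dimension of the left kernel (cokernel) of $R(p)$, i.e. $m-\operatorname{rank}R(p)$. An equilibrium stress matrix of $(G,p)$ is a real symmetric $n\times n$ matrix $\Omega$ with $\Omega_{ij}=0$ whenever $i\neq j$ and $\{i,j\}$ is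 not an edge, with the all-ones vector in its kernel, and with $\sum_j\Omega_{ij}p_j=0$ for all $i$. $p$ is in affine general position if no $k\le d+1$ of its points lie on a $(k-2)$-dimensional affine subspace. $(G,p)$ is Gstressable if $p$ is in affine general position and $(G,p)$ has an equilibrium stress matrix of rank $n-d-1$. $\operatorname{corank}(G)$ is the minimum of $\operatorname{corank}(G,p)$ over all frameworks $(G,p)$ in $\mathbb{R}^d$; $\operatorname{stressedCorank}(G)$ is the minimum of $\operatorname{corank}(G,p)$ over all Gstressable frameworks $(G,p)$ in $\mathbb{R}^d$. *)

theory Defs
  imports "HOL-Analysis.Analysis" "HOL-Library.Poly_Mapping" "HOL-Library.Extended_Nat"
begin

text \<open>
  The vertices are the elements of a finite type \<open>'n\<close>, so \<open>n = CARD('n)\<close>, and a graph is given by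
  its set of edges, each edge being a set of two vertices. The ambient space is \<open>real ^ 'd\<close>, so
  \<open>d = CARD('d) \<ge> 1\<close>. Notions that depend on \<open>d\<close> but not on a particular framework take a
  \<open>'d itself\<close> argument.
\<close>

definition simple_graph :: "'n set set \<Rightarrow> bool" where
  "simple_graph E \<longleftrightarrow> (\<forall>e\<in>E. card e = 2)"

definition connected_without :: "'n set set \<Rightarrow> 'n set \<Rightarrow> bool" where
  "connected_without E S \<longleftrightarrow>
     (\<forall>u\<in>-S. \<forall>v\<in>-S. (u, v) \<in> {(x, y). x \<notin> S \<and> y \<notin> S \<and> {x, y} \<in> E}\<^sup>*)"

definition k_connected :: "nat \<Rightarrow> 'n::finite set set \<Rightarrow> bool" where
  "k_connected k E \<longleftrightarrow> CARD('n) \<ge> k + 1 \<and> (\<forall>S. card S < k \<longrightarrow> connected_without E S)"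


definition equivalent_frameworks ::
    "'n set set \<Rightarrow> ('n \<Rightarrow> real ^ 'd::finite) \<Rightarrow> ('n \<Rightarrow> real ^ 'd) \<Rightarrow> bool" where
  "equivalent_frameworks E p q \<longleftrightarrow>
     (\<forall>i j. {i, j} \<in> E \<longrightarrow> norm (p i - p j) = norm (q i - q j))"

text \<open>Euclidean motions may reverse orientation.\<close>

definition euclidean_motion :: "(real ^ 'd::finite \<Rightarrow> real ^ 'd) \<Rightarrow> bool" where
  "euclidean_motion T \<longleftrightarrow> (\<exists>a f. orthogonal_transformation f \<and> T = (\<lambda>x. a + f x))"

definition congruent_frameworks ::
    "('n \<Rightarrow> real ^ 'd::finite) \<Rightarrow> ('n \<Rightarrow> real ^ 'd) \<Rightarrow> bool" where
  "congruent_frameworks p q \<longleftrightarrow> (\<exists>T. euclidean_motion T \<and> (\<forall>i. q i = T (p i)))"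

definition globally_rigid :: "'n set set \<Rightarrow> ('n \<Rightarrow> real ^ 'd::finite) \<Rightarrow> bool" where
  "globally_rigid E p \<longleftrightarrow>
     (\<forall>q. equivalent_frameworks E p q \<longrightarrow> congruent_frameworks p q)"


text \<open>
  A polynomial over \<open>\<rat>\<close> in variables indexed by \<open>'i\<close> is a finitely supported map from monomials
  to coefficients, a monomial being a finitely supported map from variables to exponents.
\<close>

definition eval_rat_poly :: "('i \<Rightarrow> real) \<Rightarrow> (('i \<Rightarrow>\<^sub>0 nat) \<Rightarrow>\<^sub>0 rat) \<Rightarrow> real" where
  "eval_rat_poly x f =
     (\<Sum>m\<in>Poly_Mapping.keys f. of_rat (Poly_Mapping.lookup f m) *
        (\<Prod>i\<in>Poly_Mapping.keys m. x i ^ Poly_Mapping.lookup m i))"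

definition alg_independent_over_rat :: "('i \<Rightarrow> real) \<Rightarrow> bool" where
  "alg_independent_over_rat x \<longleftrightarrow> (\<forall>f. eval_rat_poly x f = 0 \<longrightarrow> f = 0)"

definition generic_configuration :: "('n \<Rightarrow> real ^ 'd::finite) \<Rightarrow> bool" where
  "generic_configuration p \<longleftrightarrow> alg_independent_over_rat (\<lambda>(i, c). p i $ c)"

definition generically_globally_rigid :: "'d::finite itself \<Rightarrow> 'n set set \<Rightarrow> bool" where
  "generically_globally_rigid _ E \<longleftrightarrow>
     (\<forall>p :: 'n \<Rightarrow> real ^ 'd. generic_configuration p \<longrightarrow> globally_rigid E p)"


text \<open>
  The rows of the rigidity matrix are indexed by all sets of vertices; those that are not edges
  contribute zero rows. In the row of an edge \<open>{i, j}\<close> the sum below has the single nonzero term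
  \<open>p i - p j\<close> in the block of columns of \<open>i\<close> and \<open>p j - p i\<close> in that of \<open>j\<close>.
\<close>

definition rigidity_matrix ::
    "'n::finite set set \<Rightarrow> ('n \<Rightarrow> real ^ 'd::finite) \<Rightarrow> real ^ ('n \<times> 'd) ^ ('n set)" where
  "rigidity_matrix E p =
     (\<chi> e. vec_lambda (\<lambda>(k, c). if e \<in> E \<and> k \<in> e then (\<Sum>l\<in>e. p k - p l) $ c else 0))"

lemma rigidity_matrix_mult:
  fixes p p' :: "'n::finite \<Rightarrow> real ^ 'd::finite"
  assumes "{i, j} \<in> E" "i \<noteq> j"
  shows "(rigidity_matrix E p *v vec_lambda (\<lambda>(k, c). p' k $ c)) $ {i, j} = (p j - p i) \<bullet> (p' j - p' i)"
proof -
  have "(rigidity_matrix E p *v vec_lambda (\<lambda>(k, c). p' k $ c)) $ {i, j}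
      = (\<Sum>(k, c)\<in>UNIV \<times> UNIV. (if k \<in> {i, j} then (\<Sum>l\<in>{i, j}. p k - p l) $ c else 0) * p' k $ c)"
    using assms(1)
    by (auto simp: rigidity_matrix_def matrix_vector_mult_def intro!: sum.cong)
  also have "\<dots> = (\<Sum>k\<in>UNIV. if k \<in> {i, j} then (\<Sum>l\<in>{i, j}. p k - p l) \<bullet> p' k else 0)"
    by (subst sum.cartesian_product [symmetric]) (auto simp: inner_vec_def intro!: sum.cong)
  also have "\<dots> = (\<Sum>k\<in>{i, j}. (\<Sum>l\<in>{i, j}. p k - p l) \<bullet> p' k)"
    by (rule sum.mono_neutral_cong_right) auto
  also have "\<dots> = (p j - p i) \<bullet> (p' j - p' i)"
    using assms(2) by (simp add: inner_diff_left inner_diff_right)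
  finally show ?thesis .
qed

text \<open>The left kernel of the \<open>m\<close> rows that belong to edges.\<close>

definition rigidity_cokernel ::
    "'n::finite set set \<Rightarrow> ('n \<Rightarrow> real ^ 'd::finite) \<Rightarrow> (real ^ ('n set)) set" where
  "rigidity_cokernel E p = {w. (\<forall>e. e \<notin> E \<longrightarrow> w $ e = 0) \<and> w v* rigidity_matrix E p = 0}"

definition framework_corank :: "'n::finite set set \<Rightarrow> ('n \<Rightarrow> real ^ 'd::finite) \<Rightarrow> nat" where
  "framework_corank E p = dim (rigidity_cokernel E p)"


definition equilibrium_stress_matrix ::
    "'n::finite set set \<Rightarrow> ('n \<Rightarrow> real ^ 'd::finite) \<Rightarrow> real ^ 'n ^ 'n \<Rightarrow> bool" where
  "equilibrium_stress_matrix E p \<Omega> \<longleftrightarrow>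
     transpose \<Omega> = \<Omega> \<and>
     (\<forall>i j. i \<noteq> j \<and> {i, j} \<notin> E \<longrightarrow> \<Omega> $ i $ j = 0) \<and>
     \<Omega> *v (\<chi> i. 1) = 0 \<and>
     (\<forall>i. (\<Sum>j\<in>UNIV. \<Omega> $ i $ j *\<^sub>R p j) = 0)"

text \<open>Here \<open>k = card S\<close>, and repeated points of the configuration count separately.\<close>

definition affine_general_position :: "('n::finite \<Rightarrow> real ^ 'd::finite) \<Rightarrow> bool" where
  "affine_general_position p \<longleftrightarrow>
     (\<forall>S. card S \<le> CARD('d) + 1 \<longrightarrow>
        \<not> (\<exists>A. affine A \<and> aff_dim A = int (card S) - 2 \<and> p ` S \<subseteq> A))"

definition gstressable :: "'n::finite set set \<Rightarrow> ('n \<Rightarrow> real ^ 'd::finite) \<Rightarrow> bool" where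
  "gstressable E p \<longleftrightarrow> affine_general_position p \<and>
     (\<exists>\<Omega>. equilibrium_stress_matrix E p \<Omega> \<and> int (rank \<Omega>) = int CARD('n) - int CARD('d) - 1)"


text \<open>
  The minima are taken in \<open>enat\<close>, where the minimum over the empty set is \<open>\<infinity>\<close>; this only matters
  for the stressed corank of a graph without Gstressable frameworks in \<open>\<real>\<^sup>d\<close>.
\<close>

definition graph_corank :: "'d::finite itself \<Rightarrow> 'n::finite set set \<Rightarrow> enat" where
  "graph_corank _ E = (INF p :: 'n \<Rightarrow> real ^ 'd. enat (framework_corank E p))"

definition stressed_corank :: "'d::finite itself \<Rightarrow> 'n::finite set set \<Rightarrow> enat" where
  "stressed_corank _ E =
     (INF p \<in> {p :: 'n \<Rightarrow> real ^ 'd. gstressable E p}. enat (framework_corank E p))"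

end

theory Submission
  imports Defs "HOL-Computational_Algebra.Polynomial"
begin

text \<open>
  Suppose that a Gstressable framework \<open>x\<close> has the least possible corank, let \<open>p\<close> be generic and
  let \<open>q\<close> be equivalent to \<open>p\<close>. Polynomials over \<open>\<rat>\<close> that do not vanish at \<open>x\<close> do not vanish
  at \<open>p\<close>; hence \<open>p\<close> also has the least corank, and Cramer's rule, with rational values close to
  those at \<open>x\<close> for the free coordinates of the stress, gives a stress \<open>\<Omega>\<close> of \<open>p\<close> whose kernel
  consists of the affine functions of \<open>p\<close>.

  Since the coordinates of \<open>p\<close> are algebraically independent, every velocity of \<open>p\<close> is given by a
  derivation of the field \<open>\<real>\<close>. Applied to the equations that make the squared edge lengths of \<open>p\<close>
  and \<open>q\<close> equal, it shows that the rigidity matrix of \<open>p\<close> has its range inside that of \<open>q\<close>. So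
  stresses of \<open>q\<close> are stresses of \<open>p\<close>, and the two stress spaces are equal because \<open>p\<close> has the
  least corank. Therefore \<open>\<Omega>\<close> is a stress of \<open>q\<close>, which makes \<open>q\<close> an affine image of \<open>p\<close>.
  Every vertex has degree at least \<open>d\<close>, which forces the affine map to be a Euclidean motion.
\<close>

section \<open>Derivations of the real field\<close>

text \<open>
  A derivation on a subring of \<open>\<real>\<close> is the same as a subring of the dual numbers
  \<open>\<real>[\<epsilon>]\<close> that is the graph of a function; such graphs can be extended one
  element at a time.
\<close>

datatype dual = Dual (re: real) (eps: real)

instantiation dual :: "{comm_ring_1, real_algebra_1}"
begin
definition "0 = Dual 0 0"
definition "1 = Dual 1 0"
definition "x + y = Dual (re x + re y) (eps x + eps y)"
definition "x - y = Dual (re x - re y) (eps x - eps y)"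
definition "- x = Dual (- re x) (- eps x)"
definition "x * y = Dual (re x * re y) (re x * eps y + eps x * re y)"
definition "scaleR r x = Dual (r * re x) (r * eps x)"
instance
  by standard
    (auto simp: zero_dual_def one_dual_def plus_dual_def minus_dual_def uminus_dual_def
      times_dual_def scaleR_dual_def algebra_simps)
end

lemma re_simps [simp]:
  "re 0 = 0" "re 1 = 1" "re (x + y) = re x + re y" "re (x - y) = re x - re y"
  "re (- x) = - re x" "re (x * y) = re x * re y" "re (r *\<^sub>R x) = r * re x"
  by (simp_all add: zero_dual_def one_dual_def plus_dual_def minus_dual_def uminus_dual_def
      times_dual_def scaleR_dual_def)

lemma eps_simps [simp]:
  "eps 0 = 0" "eps 1 = 0" "eps (x + y) = eps x + eps y" "eps (x - y) = eps x - eps y"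
  "eps (- x) = - eps x" "eps (x * y) = re x * eps y + eps x * re y" "eps (r *\<^sub>R x) = r * eps x"
  by (simp_all add: zero_dual_def one_dual_def plus_dual_def minus_dual_def uminus_dual_def
      times_dual_def scaleR_dual_def)

lemma dual_eq_iff: "x = y \<longleftrightarrow> re x = re y \<and> eps x = eps y"
  by (cases x; cases y) auto

lemma re_of_nat [simp]: "re (of_nat n) = of_nat n"
  by (induction n) auto

lemma re_power [simp]: "re (x ^ n) = re x ^ n"
  by (induction n) auto

lemma re_sum [simp]: "re (sum f A) = (\<Sum>i\<in>A. re (f i))"
  by (induction A rule: infinite_finite_induct) auto

lemma re_prod [simp]: "re (prod f A) = (\<Prod>i\<in>A. re (f i))"
  by (induction A rule: infinite_finite_induct) auto

lemma re_of_real [simp]: "re (of_real r) = r"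
  by (simp add: of_real_def)

definition closed_ring :: "'a::comm_ring_1 set \<Rightarrow> bool" where
  "closed_ring R \<longleftrightarrow> 1 \<in> R \<and> (\<forall>x\<in>R. \<forall>y\<in>R. x - y \<in> R \<and> x * y \<in> R)"

lemma closed_ringD:
  assumes "closed_ring R"
  shows "1 \<in> R" "0 \<in> R" "x \<in> R \<Longrightarrow> y \<in> R \<Longrightarrow> x - y \<in> R" "x \<in> R \<Longrightarrow> y \<in> R \<Longrightarrow> x + y \<in> R"
    "x \<in> R \<Longrightarrow> y \<in> R \<Longrightarrow> x * y \<in> R" "of_nat n \<in> R" "(\<And>i. i \<in> I \<Longrightarrow> f i \<in> R) \<Longrightarrow> sum f I \<in> R"
proof -
  show one: "1 \<in> R" and diff: "\<And>x y. x \<in> R \<Longrightarrow> y \<in> R \<Longrightarrow> x - y \<in> R"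
    and "x \<in> R \<Longrightarrow> y \<in> R \<Longrightarrow> x * y \<in> R"
    using assms by (auto simp: closed_ring_def)
  show zero: "0 \<in> R"
    using diff[OF one one] by simp
  show plus: "x + y \<in> R" if "x \<in> R" "y \<in> R" for x y
    using diff[OF that(1) diff[OF zero that(2)]] by simp
  show "of_nat n \<in> R"
    by (induction n) (auto simp: zero one plus)
  show "(\<And>i. i \<in> I \<Longrightarrow> f i \<in> R) \<Longrightarrow> sum f I \<in> R"
    by (induction I rule: infinite_finite_induct) (auto simp: zero plus)
qed

text \<open>In a subring this makes \<open>re\<close> injective, by taking differences, so the
  subring is the graph of a derivation on its real parts.\<close>

definition single_valued_duals :: "dual set \<Rightarrow> bool" where
  "single_valued_duals R \<longleftrightarrow> (\<forall>z\<in>R. re z = 0 \<longrightarrow> z = 0)"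

definition polys_over :: "'a::zero set \<Rightarrow> 'a poly set" where
  "polys_over R = {f. \<forall>i. coeff f i \<in> R}"

lemma closed_ring_polys_over:
  assumes "closed_ring R"
  shows "closed_ring (polys_over R)"
  unfolding closed_ring_def polys_over_def
  by (auto simp: closed_ringD[OF assms] coeff_mult intro!: closed_ringD[OF assms])

text \<open>A Taylor expansion stops after the linear term when the increment has square zero.
  \<open>f'\<close> is the formal derivative, over rings that may have zero divisors, as
  \<open>dual\<close> has.\<close>

lemma poly_derivative_exists:
  fixes f :: "'a::comm_ring_1 poly"
  shows "\<exists>f'. (\<forall>i. coeff f' i = of_nat (Suc i) * coeff f (Suc i)) \<and>
    (\<forall>z e. e * e = 0 \<longrightarrow> poly f (z + e) = poly f z + e * poly f' z)"
proof (induction f)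
  case 0
  show ?case by (rule exI[of _ 0]) simp
next
  case (pCons c f)
  then obtain f' where f': "\<And>i. coeff f' i = of_nat (Suc i) * coeff f (Suc i)"
    "\<And>z e. e * e = 0 \<Longrightarrow> poly f (z + e) = poly f z + e * poly f' z"
    by blast
  \<comment> \<open>The witness is the product rule applied to \<open>c + X * f\<close>.\<close>
  show ?case
  proof (intro exI[of _ "f + pCons 0 f'"] conjI allI impI)
    fix i show "coeff (f + pCons 0 f') i = of_nat (Suc i) * coeff (pCons c f) (Suc i)"
      by (cases i) (auto simp: f' algebra_simps)
  next
    fix z e :: 'a assume e: "e * e = 0"
    have "(z + e) * (poly f z + e * poly f' z) =
      z * poly f z + e * (poly f z + z * poly f' z) + (e * e) * poly f' z"
      by (simp add: algebra_simps)
    with e show "poly (pCons c f) (z + e) = poly (pCons c f) z + e * poly (f + pCons 0 f') z"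
      by (simp add: f'(2)[OF e])
  qed
qed

text \<open>Adjoining a real \<open>a\<close> leaves only its derivative \<open>b\<close> to choose.
  If \<open>a\<close> is transcendental over the real parts of \<open>R\<close>, then
  \<open>b = 0\<close> works. Otherwise a polynomial of least degree with root \<open>a\<close>
  dictates \<open>b\<close>, and division by it shows that no conflict arises.\<close>

lemma single_valued_adjoin:
  assumes R: "closed_ring R" and sv: "single_valued_duals R"
  shows "\<exists>b. single_valued_duals ((\<lambda>f. poly f (Dual a b)) ` polys_over R)"
proof -
  note RD = closed_ringD[OF R]
  \<comment> \<open>Nonzero elements of \<open>R\<close> are thus units among the dual numbers, so
    leading coefficients can be cancelled in spite of zero divisors.\<close>
  have nz: "re x \<noteq> 0" if "x \<in> R" "x \<noteq> 0" for x
    using sv that by (auto simp: single_valued_duals_def)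
  have shift: "poly f (Dual a b) = poly f (Dual a 0) + Dual 0 b * poly f' (Dual a 0)"
    if "\<forall>z e. e * e = 0 \<longrightarrow> poly f (z + e) = poly f z + e * poly f' z" for f f' b
  proof -
    have "Dual 0 b * Dual 0 b = 0" "Dual a b = Dual a 0 + Dual 0 b"
      by (simp_all add: dual_eq_iff)
    with that show ?thesis by metis
  qed
  have re_shift: "re (poly f (Dual a b)) = re (poly f (Dual a 0))" for f b
  proof -
    obtain f' where "\<forall>z e. e * e = 0 \<longrightarrow> poly f (z + e) = poly f z + e * poly f' z"
      using poly_derivative_exists[of f] by blast
    from shift[OF this, of b] show ?thesis by simp
  qed
  \<comment> \<open>The nonzero polynomials with root \<open>a\<close> up to \<epsilon>. By
    \<open>re_shift\<close> this does not depend on the derivative given to \<open>a\<close>, so it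
    is tested at \<open>Dual a 0\<close>.\<close>
  define Z where "Z f \<longleftrightarrow> f \<in> polys_over R \<and> f \<noteq> 0 \<and> re (poly f (Dual a 0)) = 0" for f
  show ?thesis
  proof (cases "\<exists>f. Z f")
    case False
    then show ?thesis
      by (intro exI[of _ 0]) (auto simp: single_valued_duals_def Z_def)
  next
    case True
    define h where "h = arg_min degree Z"
    have h: "Z h" and h_min: "\<And>f. Z f \<Longrightarrow> degree h \<le> degree f"
      using arg_min_nat_lemma[of Z _ degree] True unfolding h_def by blast+
    have hR: "\<And>i. coeff h i \<in> R" and "h \<noteq> 0" and h0: "re (poly h (Dual a 0)) = 0"
      using h by (auto simp: Z_def polys_over_def)
    have lc: "re (lead_coeff h) \<noteq> 0"
      using nz hR \<open>h \<noteq> 0\<close> by simp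
    have deg: "degree h > 0"
    proof (rule ccontr)
      assume "\<not> degree h > 0"
      then obtain c where "h = [:c:]"
        using degree_eq_zeroE by blast
      with lc h0 show False by (simp add: Z_def)
    qed
    obtain h' where h': "\<And>i. coeff h' i = of_nat (Suc i) * coeff h (Suc i)"
      and h'_shift: "\<forall>z e. e * e = 0 \<longrightarrow> poly h (z + e) = poly h z + e * poly h' z"
      using poly_derivative_exists[of h] by blast
    have "re (coeff h' (degree h - 1)) \<noteq> 0"
      using lc deg by (simp add: h' del: of_nat_Suc)
    then have "h' \<noteq> 0" by auto
    moreover have "h' \<in> polys_over R"
      unfolding polys_over_def using h' hR RD by simp
    moreover have "degree h' < degree h"
      using deg by (intro degree_lessI) (auto simp: h' coeff_eq_0)
    \<comment> \<open>A vanishing real part would put \<open>h'\<close> into \<open>Z\<close>,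
      against the minimality of the degree of \<open>h\<close>.\<close>
    ultimately have h'0: "re (poly h' (Dual a 0)) \<noteq> 0"
      using h_min[of h'] by (auto simp: Z_def)
    \<comment> \<open>Solves for a zero \<epsilon>-part of \<open>h\<close> at
      \<open>Dual a b\<close>, which is linear in \<open>b\<close> with slope
      \<open>re (poly h' (Dual a 0))\<close>.\<close>
    define b where "b = - eps (poly h (Dual a 0)) / re (poly h' (Dual a 0))"
    have root: "poly h (Dual a b) = 0"
      using h0 h'0 by (subst shift[OF h'_shift]) (simp add: dual_eq_iff b_def)
    have "poly f (Dual a b) = 0" if "f \<in> polys_over R" "re (poly f (Dual a b)) = 0" for f
      using that
    proof (induction "degree f" arbitrary: f rule: less_induct)
      case less
      show ?case
      proof (cases "degree f < degree h \<or> f = 0")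
        case True
        then have "f = 0"
          using less.prems h_min[of f] unfolding Z_def re_shift[of f b] by force
        then show ?thesis by simp
      next
        case False
        \<comment> \<open>One step of pseudo-division by \<open>h\<close>: scaling by leading
          coefficients keeps \<open>g\<close> over \<open>R\<close> and cancels the top terms, and
          at the root of \<open>h\<close> only the multiple of \<open>f\<close> survives.\<close>
        define g where
          "g = smult (lead_coeff h) f - smult (lead_coeff f) (monom 1 (degree f - degree h) * h)"
        have g_eval: "poly g (Dual a b) = lead_coeff h * poly f (Dual a b)"
          by (simp add: g_def root)
        have "coeff g i = 0" if "i \<ge> degree f" for i
        proof (cases "i = degree f")
          case True
          then show ?thesis using False by (simp add: g_def coeff_monom_mult)
        next
          case ne: False
          then have "coeff f i = 0" "coeff h (i - (degree f - degree h)) = 0"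
            using that False by (auto intro!: coeff_eq_0)
          then show ?thesis
            by (simp add: g_def coeff_monom_mult)
        qed
        then have "degree g < degree f"
          using deg False by (intro degree_lessI) auto
        moreover have "g \<in> polys_over R"
          using less.prems(1) hR
          by (auto simp: g_def polys_over_def coeff_monom_mult RD intro!: RD)
        moreover have "re (poly g (Dual a b)) = 0"
          using less.prems by (simp add: g_eval)
        ultimately have "poly g (Dual a b) = 0"
          using less.hyps by blast
        with lc less.prems(2) show ?thesis
          by (simp add: g_eval dual_eq_iff)
      qed
    qed
    then show ?thesis
      by (auto simp: single_valued_duals_def)
  qed
qed

lemma closed_ring_adjoin:
  fixes R :: "'a::comm_ring_1 set"
  assumes R: "closed_ring R"
  shows "closed_ring ((\<lambda>f. poly f z) ` polys_over R)"
    and "R \<subseteq> (\<lambda>f. poly f z) ` polys_over R"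
    and "z \<in> (\<lambda>f. poly f z) ` polys_over R"
proof -
  note RD = closed_ringD[OF R]
  note PD = closed_ringD[OF closed_ring_polys_over[OF R]]
  show "closed_ring ((\<lambda>f. poly f z) ` polys_over R)"
    unfolding closed_ring_def
  proof (intro conjI ballI; (elim imageE)?)
    show "1 \<in> (\<lambda>f. poly f z) ` polys_over R"
      by (rule image_eqI[of _ _ 1]) (auto simp: PD)
  next
    fix x y f g assume *: "x = poly f z" "f \<in> polys_over R" "y = poly g z" "g \<in> polys_over R"
    show "x - y \<in> (\<lambda>f. poly f z) ` polys_over R"
      using * by (intro image_eqI[of _ _ "f - g"]) (auto simp: PD)
    show "x * y \<in> (\<lambda>f. poly f z) ` polys_over R"
      using * by (intro image_eqI[of _ _ "f * g"]) (auto simp: PD)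
  qed
  show "R \<subseteq> (\<lambda>f. poly f z) ` polys_over R"
  proof
    fix x assume "x \<in> R"
    then show "x \<in> (\<lambda>f. poly f z) ` polys_over R"
      by (intro image_eqI[of _ _ "[:x:]"]) (auto simp: polys_over_def coeff_pCons RD split: nat.split)
  qed
  show "z \<in> (\<lambda>f. poly f z) ` polys_over R"
    by (rule image_eqI[of _ _ "[:0, 1:]"]) (auto simp: polys_over_def coeff_pCons RD split: nat.split)
qed

text \<open>Zorn's lemma gives a maximal graph containing \<open>R\<close>. It is total, since
  \<open>single_valued_adjoin\<close> would otherwise enlarge it by one more real.\<close>

lemma derivation_extends:
  assumes R: "closed_ring R" and sv: "single_valued_duals R"
  obtains D :: "real \<Rightarrow> real" where "\<And>x y. D (x - y) = D x - D y"
    "\<And>x y. D (x * y) = x * D y + D x * y" "\<And>z. z \<in> R \<Longrightarrow> D (re z) = eps z" "D 0 = 0"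
proof -
  define \<A> where "\<A> = {M. R \<subseteq> M \<and> closed_ring M \<and> single_valued_duals M}"
  have "\<exists>M\<in>\<A>. \<forall>X\<in>\<A>. M \<subseteq> X \<longrightarrow> X = M"
  proof (rule subset_Zorn_nonempty)
    show "\<A> \<noteq> {}" using R sv by (auto simp: \<A>_def)
  next
    fix C assume C: "C \<noteq> {}" "subset.chain \<A> C"
    have sub: "M \<in> \<A>" if "M \<in> C" for M
      using C that by (auto simp: subset_chain_def)
    have "closed_ring (\<Union>C)"
      unfolding closed_ring_def
    proof (intro conjI ballI)
      show "1 \<in> \<Union>C" using C(1) sub by (auto simp: \<A>_def closed_ring_def)
      fix x y assume "x \<in> \<Union>C" "y \<in> \<Union>C"
      then obtain M where "M \<in> C" "x \<in> M" "y \<in> M"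
        using C(2) by (auto simp: subset_chain_def) blast
      then show "x - y \<in> \<Union>C" "x * y \<in> \<Union>C"
        using sub by (auto simp: \<A>_def closed_ring_def)
    qed
    then show "\<Union>C \<in> \<A>"
      using C(1) sub by (fastforce simp: \<A>_def single_valued_duals_def)
  qed
  then obtain M where "M \<in> \<A>" and max: "\<And>X. X \<in> \<A> \<Longrightarrow> M \<subseteq> X \<Longrightarrow> X = M"
    by blast
  then have M: "R \<subseteq> M" "closed_ring M" "single_valued_duals M"
    by (auto simp: \<A>_def)
  have "\<exists>b. Dual a b \<in> M" for a
  proof -
    obtain b where b: "single_valued_duals ((\<lambda>f. poly f (Dual a b)) ` polys_over M)"
      using single_valued_adjoin[OF M(2,3)] by blast
    then have "(\<lambda>f. poly f (Dual a b)) ` polys_over M = M"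
      using closed_ring_adjoin[OF M(2), of "Dual a b"] M(1) by (intro max) (auto simp: \<A>_def)
    then show ?thesis
      using closed_ring_adjoin(3)[OF M(2), of "Dual a b"] by auto
  qed
  then obtain D where D: "\<And>a. Dual a (D a) \<in> M"
    by metis
  have D_eq: "D (re z) = eps z" if "z \<in> M" for z
  proof -
    have "Dual (re z) (D (re z)) - z \<in> M"
      by (rule closed_ringD(3)[OF M(2) D that])
    then have "Dual (re z) (D (re z)) - z = 0"
      using M(3) by (auto simp: single_valued_duals_def)
    then show ?thesis by (simp add: dual_eq_iff)
  qed
  show thesis
  proof
    show "D (x - y) = D x - D y" for x y
      using D_eq[OF closed_ringD(3)[OF M(2) D[of x] D[of y]]] by simp
    show "D (x * y) = x * D y + D x * y" for x y
      using D_eq[OF closed_ringD(5)[OF M(2) D[of x] D[of y]]] by simp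
    show "D (re z) = eps z" if "z \<in> R" for z
      using D_eq that M(1) by blast
    show "D 0 = 0"
      using D_eq[OF closed_ringD(2)[OF M(2)]] by simp
  qed
qed

section \<open>Rational polynomial functions\<close>

text \<open>
  Taking the values in any real algebra covers \<open>\<real>\<close> and the dual numbers at once.
\<close>

definition poly_value :: "('i \<Rightarrow> 'a::{comm_ring_1,real_algebra_1}) \<Rightarrow> (('i \<Rightarrow>\<^sub>0 nat) \<Rightarrow>\<^sub>0 rat) \<Rightarrow> 'a" where
  "poly_value x f =
     (\<Sum>m\<in>Poly_Mapping.keys f. of_real (of_rat (Poly_Mapping.lookup f m)) *
        (\<Prod>i\<in>Poly_Mapping.keys m. x i ^ Poly_Mapping.lookup m i))"

lemma eval_rat_poly_eq: "eval_rat_poly x f = poly_value x f"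
  by (simp add: eval_rat_poly_def poly_value_def)

lemma re_poly_value: "re (poly_value x f) = eval_rat_poly (\<lambda>i. re (x i)) f"
  by (simp add: eval_rat_poly_def poly_value_def)

lemma poly_value_superset:
  assumes "finite K" "Poly_Mapping.keys f \<subseteq> K"
  shows "poly_value x f = (\<Sum>m\<in>K. of_real (of_rat (Poly_Mapping.lookup f m)) *
        (\<Prod>i\<in>Poly_Mapping.keys m. x i ^ Poly_Mapping.lookup m i))"
  unfolding poly_value_def using assms
  by (intro sum.mono_neutral_left) (auto simp: in_keys_iff)

lemma poly_value_add: "poly_value x (f + g) = poly_value x f + poly_value x g"
  using keys_add[of f g]
  by (simp add: poly_value_superset[of "Poly_Mapping.keys f \<union> Poly_Mapping.keys g"]
      lookup_add of_rat_add distrib_right sum.distrib)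

lemma poly_value_0 [simp]: "poly_value x 0 = 0"
  by (simp add: poly_value_def)

lemma poly_value_uminus: "poly_value x (- f) = - poly_value x f"
  using poly_value_add[of x f "- f"] by (simp add: eq_neg_iff_add_eq_0 add.commute)

lemma poly_value_diff: "poly_value x (f - g) = poly_value x f - poly_value x g"
  using poly_value_add[of x f "- g"] by (simp add: poly_value_uminus)

lemma poly_value_sum: "poly_value x (sum f I) = (\<Sum>i\<in>I. poly_value x (f i))"
  by (induction I rule: infinite_finite_induct) (auto simp: poly_value_add)

lemma poly_value_single:
  "poly_value x (Poly_Mapping.single m a) = of_real (of_rat a) *
     (\<Prod>i\<in>Poly_Mapping.keys m. x i ^ Poly_Mapping.lookup m i)"
  by (simp add: poly_value_def)

lemma monomial_value_add:
  fixes x :: "'i \<Rightarrow> 'a::comm_ring_1"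
  shows "(\<Prod>i\<in>Poly_Mapping.keys (m + n). x i ^ Poly_Mapping.lookup (m + n) i) =
    (\<Prod>i\<in>Poly_Mapping.keys m. x i ^ Poly_Mapping.lookup m i) *
    (\<Prod>i\<in>Poly_Mapping.keys n. x i ^ Poly_Mapping.lookup n i)"
proof -
  have *: "(\<Prod>i\<in>Poly_Mapping.keys l. x i ^ Poly_Mapping.lookup l i) =
      (\<Prod>i\<in>Poly_Mapping.keys m \<union> Poly_Mapping.keys n. x i ^ Poly_Mapping.lookup l i)"
    if "Poly_Mapping.keys l \<subseteq> Poly_Mapping.keys m \<union> Poly_Mapping.keys n" for l :: "'i \<Rightarrow>\<^sub>0 nat"
    using that by (intro prod.mono_neutral_left) (auto simp: in_keys_iff)
  show ?thesis
    using keys_add[of m n] *[of m] *[of n] *[of "m + n"]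
    by (simp add: lookup_add power_add prod.distrib)
qed

lemma poly_mapping_eq_sum_single:
  "f = (\<Sum>m\<in>Poly_Mapping.keys f. Poly_Mapping.single m (Poly_Mapping.lookup f m))"
  by (rule poly_mapping_eqI) (auto simp: lookup_sum lookup_single when_def in_keys_iff)

lemma poly_value_mult: "poly_value x (f * g) = poly_value x f * poly_value x g"
proof -
  have *: "poly_value x (Poly_Mapping.single m a * Poly_Mapping.single n b) =
      poly_value x (Poly_Mapping.single m a) * poly_value x (Poly_Mapping.single n b)" for m n a b
    by (simp add: mult_single poly_value_single monomial_value_add of_rat_mult)
  let ?S = "\<lambda>f. \<Sum>m\<in>Poly_Mapping.keys f. Poly_Mapping.single m (Poly_Mapping.lookup f m)"
  have "poly_value x (?S f * ?S g) = poly_value x (?S f) * poly_value x (?S g)"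
    by (simp add: sum_product poly_value_sum *)
  then show ?thesis
    by (simp flip: poly_mapping_eq_sum_single)
qed

lemma closed_ring_poly_values: "closed_ring (range (poly_value x))"
  unfolding closed_ring_def
proof (intro conjI ballI; (elim rangeE)?)
  show "1 \<in> range (poly_value x)"
    using poly_value_single[of x 0 1] by (auto intro: range_eqI[of _ _ 1])
next
  fix y z f g assume "y = poly_value x f" "z = poly_value x g"
  then show "y - z \<in> range (poly_value x)" "y * z \<in> range (poly_value x)"
    by (simp_all flip: poly_value_diff poly_value_mult)
qed

lemma poly_value_variable: "x i \<in> range (poly_value x)"
  by (rule range_eqI[of _ _ "Poly_Mapping.single (Poly_Mapping.single i 1) 1"])
    (simp add: poly_value_single)

text \<open>No choice of derivatives \<open>v i\<close> can conflict: among the values of rational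
  polynomials at the duals \<open>?X i\<close>, one with real part 0 comes from the zero
  polynomial.\<close>

lemma alg_independent_derivation:
  fixes x v :: "'i \<Rightarrow> real"
  assumes "alg_independent_over_rat x"
  obtains D :: "real \<Rightarrow> real" where "\<And>x y. D (x - y) = D x - D y"
    "\<And>x y. D (x * y) = x * D y + D x * y" "\<And>i. D (x i) = v i" "D 0 = 0"
proof -
  let ?X = "\<lambda>i. Dual (x i) (v i)"
  have "single_valued_duals (range (poly_value ?X))"
    using assms by (auto simp: single_valued_duals_def alg_independent_over_rat_def re_poly_value)
  then show thesis
  proof (rule derivation_extends[OF closed_ring_poly_values])
    fix D :: "real \<Rightarrow> real"
    assume D: "\<And>x y. D (x - y) = D x - D y" "\<And>x y. D (x * y) = x * D y + D x * y"
      "\<And>z. z \<in> range (poly_value ?X) \<Longrightarrow> D (re z) = eps z" "D 0 = 0"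
    show thesis
      using D(3)[OF poly_value_variable[of ?X]] by (intro that[OF D(1,2) _ D(4)]) auto
  qed
qed

section \<open>Nonvanishing of rational polynomials at algebraically independent points\<close>

definition rat_polyfun :: "(('i \<Rightarrow> real) \<Rightarrow> real) \<Rightarrow> bool" where
  "rat_polyfun F \<longleftrightarrow> (\<exists>f. \<forall>x. F x = eval_rat_poly x f)"

lemma rat_polyfun_const: "a \<in> \<rat> \<Longrightarrow> rat_polyfun (\<lambda>x. a)"
  unfolding rat_polyfun_def
  by (elim Rats_cases, rule exI[of _ "Poly_Mapping.single 0 _"])
    (auto simp: eval_rat_poly_eq poly_value_single)

lemma rat_polyfun_variable: "rat_polyfun (\<lambda>x. x i)"
  unfolding rat_polyfun_def
  by (rule exI[of _ "Poly_Mapping.single (Poly_Mapping.single i 1) 1"])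
    (simp add: eval_rat_poly_eq poly_value_single)

lemma rat_polyfun_add:
  assumes "rat_polyfun F" "rat_polyfun G"
  shows "rat_polyfun (\<lambda>x. F x + G x)"
  using assms unfolding rat_polyfun_def eval_rat_poly_eq by (metis poly_value_add)

lemma rat_polyfun_mult:
  assumes "rat_polyfun F" "rat_polyfun G"
  shows "rat_polyfun (\<lambda>x. F x * G x)"
  using assms unfolding rat_polyfun_def eval_rat_poly_eq by (metis poly_value_mult)

lemma rat_polyfun_uminus: "rat_polyfun F \<Longrightarrow> rat_polyfun (\<lambda>x. - F x)"
  unfolding rat_polyfun_def eval_rat_poly_eq by (metis poly_value_uminus)

lemma rat_polyfun_diff:
  assumes "rat_polyfun F" "rat_polyfun G"
  shows "rat_polyfun (\<lambda>x. F x - G x)"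
  using rat_polyfun_add[OF assms(1) rat_polyfun_uminus[OF assms(2)]] by simp

lemma rat_polyfun_sum: "(\<And>i. i \<in> I \<Longrightarrow> rat_polyfun (F i)) \<Longrightarrow> rat_polyfun (\<lambda>x. \<Sum>i\<in>I. F i x)"
  by (induction I rule: infinite_finite_induct)
    (auto intro: rat_polyfun_const rat_polyfun_add)

lemma rat_polyfun_prod: "(\<And>i. i \<in> I \<Longrightarrow> rat_polyfun (F i)) \<Longrightarrow> rat_polyfun (\<lambda>x. \<Prod>i\<in>I. F i x)"
  by (induction I rule: infinite_finite_induct)
    (auto intro: rat_polyfun_const rat_polyfun_mult)

lemma rat_polyfun_if:
  assumes "b \<Longrightarrow> rat_polyfun F" "\<not> b \<Longrightarrow> rat_polyfun G"
  shows "rat_polyfun (\<lambda>x. if b then F x else G x)"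
  using assms by (cases b) auto

lemma rat_polyfun_det:
  fixes M :: "('i \<Rightarrow> real) \<Rightarrow> real ^ 'k ^ 'k"
  assumes "\<And>i j. rat_polyfun (\<lambda>x. M x $ i $ j)"
  shows "rat_polyfun (\<lambda>x. det (M x))"
  unfolding det_def
  by (intro rat_polyfun_sum rat_polyfun_mult rat_polyfun_prod assms rat_polyfun_const) auto

text \<open>If \<open>F\<close> vanished at the independent point \<open>x\<close>, its polynomial
  would be zero, and \<open>F\<close> would vanish at \<open>y\<close> too.\<close>

lemma rat_polyfun_nonzero:
  assumes "alg_independent_over_rat x" "rat_polyfun F" "F y \<noteq> 0"
  shows "F x \<noteq> 0"
  using assms unfolding rat_polyfun_def alg_independent_over_rat_def
  by (metis eval_rat_poly_eq poly_value_0)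

section \<open>Linear algebra\<close>

text \<open>Rank-nullity on a subspace: on the orthogonal complement \<open>?C\<close> of the kernel
  within \<open>S\<close>, the map is injective and has the same image.\<close>

lemma dim_kernel_add_dim_image:
  fixes f :: "'a::euclidean_space \<Rightarrow> 'b::euclidean_space"
  assumes f: "linear f" and S: "subspace S"
  shows "dim {x \<in> S. f x = 0} + dim (f ` S) = dim S"
proof -
  let ?K = "{x \<in> S. f x = 0}" and ?C = "{y \<in> S. \<forall>x\<in>{x \<in> S. f x = 0}. orthogonal x y}"
  have K: "subspace ?K"
    using S f by (auto simp: subspace_def linear_add linear_scale linear_0)
  have C: "subspace ?C"
    using S by (auto simp: subspace_def orthogonal_clauses)
  have "inj_on f ?C"
  proof (rule inj_onI)
    fix x y assume xy: "x \<in> ?C" "y \<in> ?C" "f x = f y"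
    then have "x - y \<in> ?C" "x - y \<in> ?K"
      using C f S by (auto simp: subspace_diff linear_diff orthogonal_clauses)
    then have "orthogonal (x - y) (x - y)" by blast
    then show "x = y" by (simp add: orthogonal_self)
  qed
  then have "dim (f ` ?C) = dim ?C"
    using C by (intro dim_image_eq[OF f]) (simp add: span_eq_iff[THEN iffD2])
  moreover have "f ` S = f ` ?C"
  proof (intro subset_antisym subsetI)
    fix z assume "z \<in> f ` S"
    then obtain x where x: "x \<in> S" "z = f x" by blast
    obtain y u where yu: "y \<in> span ?K" "\<And>w. w \<in> span ?K \<Longrightarrow> orthogonal u w" "x = y + u"
      using orthogonal_subspace_decomp_exists[of ?K x] by blast
    then have "y \<in> ?K" using K by (simp add: span_eq_iff[THEN iffD2])
    then have "u \<in> S" "f u = z"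
      using x yu(3) subspace_diff[OF S, of x y] linear_add[OF f, of y u] by auto
    then show "z \<in> f ` ?C"
      using yu(2) by (auto simp: span_base orthogonal_commute intro!: image_eqI[of _ _ u])
  qed auto
  ultimately show ?thesis
    using dim_subspace_orthogonal_to_vectors[OF K S] by auto
qed

lemma det_nonzero_iff: "det A \<noteq> 0 \<longleftrightarrow> (\<forall>v. A *v v = 0 \<longrightarrow> v = 0)" for A :: "real ^ 'k ^ 'k"
  by (simp add: invertible_det_nz[symmetric] invertible_left_inverse matrix_left_invertible_ker)

definition moment_matrix :: "('n \<Rightarrow> real ^ 'k) \<Rightarrow> 'n set \<Rightarrow> real ^ 'k ^ 'k" where
  "moment_matrix h S = (\<chi> a b. \<Sum>j\<in>S. h j $ a * h j $ b)"

lemma moment_matrix_mult: "moment_matrix h S *v v = (\<Sum>j\<in>S. (v \<bullet> h j) *\<^sub>R h j)"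
  by (simp add: moment_matrix_def matrix_vector_mult_def vec_eq_iff inner_vec_def
      sum_distrib_left sum_distrib_right sum.swap[of _ S] ac_simps)

text \<open>The quadratic form of the matrix at \<open>v\<close> is the sum of the squares of
  \<open>v \<bullet> h j\<close>. Spanning thereby becomes the nonvanishing of one
  polynomial.\<close>

lemma det_moment_matrix:
  assumes "finite S"
  shows "det (moment_matrix h S) \<noteq> 0 \<longleftrightarrow> (\<forall>v. (\<forall>j\<in>S. v \<bullet> h j = 0) \<longrightarrow> v = 0)"
proof -
  have "moment_matrix h S *v v = 0 \<longleftrightarrow> (\<forall>j\<in>S. v \<bullet> h j = 0)" for v
  proof
    assume "moment_matrix h S *v v = 0"
    then have "0 = v \<bullet> (\<Sum>j\<in>S. (v \<bullet> h j) *\<^sub>R h j)"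
      by (simp add: moment_matrix_mult)
    then have "(\<Sum>j\<in>S. (v \<bullet> h j)\<^sup>2) = 0"
      by (simp add: inner_sum_right power2_eq_square)
    then show "\<forall>j\<in>S. v \<bullet> h j = 0"
      using assms by (simp add: sum_nonneg_eq_0_iff)
  qed (simp add: moment_matrix_mult)
  then show ?thesis
    by (simp add: det_nonzero_iff)
qed

text \<open>Homogeneous coordinates, with \<open>None\<close> for the coordinate 1: affine functions
  of a point become inner products with a fixed vector.\<close>

definition homogenize :: "real ^ 'd \<Rightarrow> real ^ 'd option" where
  "homogenize v = (\<chi> c. case c of None \<Rightarrow> 1 | Some c \<Rightarrow> v $ c)"

lemma UNIV_option_sum: "(\<Sum>c\<in>UNIV. f c) = f None + (\<Sum>c\<in>UNIV. f (Some c))"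
  for f :: "'d::finite option \<Rightarrow> 'a::comm_monoid_add"
  by (simp add: UNIV_option_conv sum.reindex)

lemma inner_homogenize: "a \<bullet> homogenize v = a $ None + (\<chi> c. a $ Some c) \<bullet> v"
  by (simp add: homogenize_def inner_vec_def UNIV_option_sum)

text \<open>If the linear part \<open>b\<close> of \<open>a\<close> were nonzero, the d + 1 points
  would lie on a hyperplane, whose dimension d - 1 is \<open>card S - 2\<close>. With
  \<open>b = 0\<close> the constant part is 0 as well.\<close>

lemma affine_general_position_span:
  fixes x :: "'n::finite \<Rightarrow> real ^ 'd::finite"
  assumes "affine_general_position x" "card S = CARD('d) + 1" "\<forall>j\<in>S. a \<bullet> homogenize (x j) = 0"
  shows "a = 0"
proof -
  define b where "b = (\<chi> c. a $ Some c)"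
  have eq: "a $ None + b \<bullet> x j = 0" if "j \<in> S" for j
    using assms(3) that by (simp add: inner_homogenize b_def)
  have "b = 0"
  proof (rule ccontr)
    assume "b \<noteq> 0"
    then have "aff_dim {y. b \<bullet> y = - a $ None} = int (card S) - 2"
      by (subst aff_dim_hyperplane) (auto simp: assms(2))
    moreover have "x ` S \<subseteq> {y. b \<bullet> y = - a $ None}"
      using eq by (auto simp: add_eq_0_iff)
    ultimately show False
      using assms(1,2) affine_hyperplane unfolding affine_general_position_def by (metis order_refl)
  qed
  moreover have "a $ None = 0"
    using eq assms(2) \<open>b = 0\<close> by (cases "S = {}") auto
  ultimately have "a $ c = 0" for c
    by (cases c) (auto simp: b_def vec_eq_iff)
  then show ?thesis by (simp add: vec_eq_iff)
qed

section \<open>Stresses\<close>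

definition supported_on :: "'e set \<Rightarrow> (real ^ 'e) set" where
  "supported_on B = {w. \<forall>e. e \<notin> B \<longrightarrow> w $ e = 0}"

lemma subspace_supported_on: "subspace (supported_on B)"
  by (auto simp: subspace_def supported_on_def)

lemma dim_supported_on: "dim (supported_on B) = card B"
  using dim_substandard_cart[where ?'a = real, of B] by (simp add: supported_on_def dim_vec_eq)

lemma supported_on_mono: "B \<subseteq> E \<Longrightarrow> supported_on B \<subseteq> supported_on E"
  by (auto simp: supported_on_def)

text \<open>The linear dependencies among the rows in \<open>B\<close>; these rows are independent
  iff the space is \<open>{0}\<close>.\<close>

definition stresses_on ::
    "'n::finite set set \<Rightarrow> ('n \<Rightarrow> real ^ 'd::finite) \<Rightarrow> 'n set set \<Rightarrow> (real ^ ('n set)) set" where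
  "stresses_on E x B = {w \<in> supported_on B. w v* rigidity_matrix E x = 0}"

lemma rigidity_cokernel_eq: "rigidity_cokernel E x = stresses_on E x E"
  by (simp add: rigidity_cokernel_def stresses_on_def supported_on_def)

lemma linear_vector_matrix_mult: "linear (\<lambda>w. w v* M)" for M :: "real ^ 'k ^ 'm"
  using matrix_vector_mul_linear[of "transpose M"] by simp

definition row_space ::
    "'n::finite set set \<Rightarrow> ('n \<Rightarrow> real ^ 'd::finite) \<Rightarrow> 'n set set \<Rightarrow> (real ^ ('n \<times> 'd)) set" where
  "row_space E x B = (\<lambda>w. w v* rigidity_matrix E x) ` supported_on B"

lemma subspace_row_space: "subspace (row_space E x B)"
  unfolding row_space_def
  by (rule linear_subspace_image[OF linear_vector_matrix_mult subspace_supported_on])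

lemma row_space_mono: "B \<subseteq> C \<Longrightarrow> row_space E x B \<subseteq> row_space E x C"
  unfolding row_space_def by (intro image_mono supported_on_mono)

lemma subspace_stresses_on: "subspace (stresses_on E x B)"
  using subspace_supported_on[of B] linear_vector_matrix_mult[of "rigidity_matrix E x"]
  unfolding stresses_on_def subspace_def
  by (auto simp: linear_add[OF linear_vector_matrix_mult] linear_scale[OF linear_vector_matrix_mult])

lemma dim_stresses_add_dim_rows: "dim (stresses_on E x B) + dim (row_space E x B) = card B"
  unfolding stresses_on_def row_space_def
  using dim_kernel_add_dim_image[OF linear_vector_matrix_mult subspace_supported_on]
  by (simp add: dim_supported_on)

lemma vector_matrix_mult_rows: "w v* M = (\<Sum>e\<in>UNIV. w $ e *\<^sub>R M $ e)" for M :: "real ^ 'k ^ 'm"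
  by (simp add: vector_matrix_mult_def vec_eq_iff)

lemma supported_vector_matrix_mult:
  fixes M :: "real ^ 'k ^ 'm"
  assumes "w \<in> supported_on B"
  shows "w v* M = (\<Sum>e\<in>B. w $ e *\<^sub>R M $ e)"
  unfolding vector_matrix_mult_rows
  using assms by (intro sum.mono_neutral_right) (auto simp: supported_on_def)

lemma row_in_row_space: "e \<in> B \<Longrightarrow> rigidity_matrix E x $ e \<in> row_space E x B"
  unfolding row_space_def
  by (rule image_eqI[of _ _ "axis e 1"])
    (auto simp: supported_on_def axis_def vector_matrix_mult_def vec_eq_iff if_distrib[of "\<lambda>t. t * _"]
      cong: if_cong)

lemma row_space_subset:
  assumes "\<And>e. e \<in> B \<Longrightarrow> rigidity_matrix E x $ e \<in> V" "subspace V"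
  shows "row_space E x B \<subseteq> V"
  unfolding row_space_def using assms
  by (auto simp: supported_vector_matrix_mult intro!: subspace_sum subspace_scale)

text \<open>\<open>B\<close> is an independent set of rows of largest size. Adding a further row
  creates a dependency in which that row has a nonzero coefficient, so it lies in the span of
  \<open>B\<close>.\<close>

lemma row_basis_exists:
  obtains B where "B \<subseteq> E" "stresses_on E x B = {0}" "row_space E x B = row_space E x E"
proof -
  define Q where "Q B \<longleftrightarrow> B \<subseteq> E \<and> stresses_on E x B = {0}" for B
  have "Q {}"
    using subspace_0[OF subspace_stresses_on]
    by (auto simp: Q_def stresses_on_def supported_on_def vec_eq_iff)
  moreover have "\<forall>B. Q B \<longrightarrow> card B < Suc (card E)"
    by (simp add: Q_def card_mono less_Suc_eq_le)
  ultimately obtain B where B: "Q B" and max: "\<And>C. Q C \<Longrightarrow> card C \<le> card B"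
    using ex_has_greatest_nat[of Q "{}" card "Suc (card E)"] by blast
  have "rigidity_matrix E x $ e \<in> row_space E x B" if e: "e \<in> E" for e
  proof (cases "e \<in> B")
    case False
    then have "\<not> Q (insert e B)"
      using max[of "insert e B"] by auto
    then obtain w where w: "w \<in> stresses_on E x (insert e B)" "w \<noteq> 0"
      using B e subspace_0[OF subspace_stresses_on[of E x "insert e B"]]
      by (auto simp: Q_def)
    define u where "u = w - w $ e *\<^sub>R axis e 1"
    have u: "u \<in> supported_on B"
      using w(1) by (auto simp: u_def stresses_on_def supported_on_def axis_def)
    have "axis e 1 v* rigidity_matrix E x = rigidity_matrix E x $ e"
      by (simp add: axis_def vector_matrix_mult_def vec_eq_iff if_distrib[of "\<lambda>t. t * _"] cong: if_cong)
    then have eq: "u v* rigidity_matrix E x = - w $ e *\<^sub>R rigidity_matrix E x $ e"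
      using w(1) by (simp add: u_def stresses_on_def linear_diff[OF linear_vector_matrix_mult]
          linear_scale[OF linear_vector_matrix_mult])
    have "w $ e \<noteq> 0"
    proof
      assume "w $ e = 0"
      then have "w \<in> stresses_on E x B"
        using w(1) u by (simp add: u_def stresses_on_def)
      then show False using B w(2) by (simp add: Q_def)
    qed
    then have "rigidity_matrix E x $ e = (- inverse (w $ e)) *\<^sub>R (u v* rigidity_matrix E x)"
      by (simp add: eq)
    moreover have "u v* rigidity_matrix E x \<in> row_space E x B"
      using u by (auto simp: row_space_def)
    ultimately show ?thesis
      by (metis subspace_scale subspace_row_space)
  qed (rule row_in_row_space)
  then have "row_space E x B = row_space E x E"
    using B by (intro subset_antisym row_space_subset row_space_mono subspace_row_space)
      (auto simp: Q_def)
  with B that show thesis by (auto simp: Q_def)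
qed

section \<open>Row Gram matrices and stresses from Cramer's rule\<close>

definition row_gram ::
    "'n::finite set set \<Rightarrow> 'n set set \<Rightarrow> ('n \<Rightarrow> real ^ 'd::finite) \<Rightarrow> real ^ ('n set) ^ ('n set)" where
  "row_gram E B x = (\<chi> e f. if e \<in> B \<and> f \<in> B then rigidity_matrix E x $ e \<bullet> rigidity_matrix E x $ f
     else if e = f then 1 else 0)"

lemma row_gram_mult:
  "(row_gram E B x *v w) $ e =
    (if e \<in> B then rigidity_matrix E x $ e \<bullet> (\<Sum>f\<in>B. w $ f *\<^sub>R rigidity_matrix E x $ f) else w $ e)"
proof (cases "e \<in> B")
  case True
  then have "(row_gram E B x *v w) $ e =
      (\<Sum>f\<in>B. (rigidity_matrix E x $ e \<bullet> rigidity_matrix E x $ f) * w $ f)"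
    by (auto simp: row_gram_def matrix_vector_mult_def intro!: sum.mono_neutral_cong_right)
  with True show ?thesis
    by (simp add: inner_sum_right mult.commute)
next
  case False
  then show ?thesis
    by (simp add: row_gram_def matrix_vector_mult_def if_distrib[of "\<lambda>t. t * _"] cong: if_cong)
qed

text \<open>For \<open>w\<close> in the kernel, the combination \<open>?z\<close> of the rows in
  \<open>B\<close> is orthogonal to each of them, hence to itself. The identity block outside
  \<open>B\<close> forces \<open>w\<close> to vanish there.\<close>

lemma det_row_gram: "det (row_gram E B x) \<noteq> 0 \<longleftrightarrow> stresses_on E x B = {0}"
proof -
  have "row_gram E B x *v w = 0 \<longleftrightarrow> w \<in> stresses_on E x B" for w
  proof
    assume w: "row_gram E B x *v w = 0"
    let ?z = "\<Sum>f\<in>B. w $ f *\<^sub>R rigidity_matrix E x $ f"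
    have *: "if e \<in> B then rigidity_matrix E x $ e \<bullet> ?z = 0 else w $ e = 0" for e
      using row_gram_mult[of E B x w e] w by (simp split: if_splits)
    then have supp: "w \<in> supported_on B"
      by (auto simp: supported_on_def)
    have "?z \<bullet> ?z = (\<Sum>e\<in>B. w $ e * (rigidity_matrix E x $ e \<bullet> ?z))"
      by (simp only: inner_sum_left inner_scaleR_left)
    also have "\<dots> = 0"
      using * by (intro sum.neutral) auto
    finally show "w \<in> stresses_on E x B"
      using supp by (simp add: stresses_on_def supported_vector_matrix_mult)
  next
    assume w: "w \<in> stresses_on E x B"
    then have "(\<Sum>f\<in>B. w $ f *\<^sub>R rigidity_matrix E x $ f) = 0"
      by (auto simp: stresses_on_def supported_vector_matrix_mult)
    then have "(row_gram E B x *v w) $ e = 0" for e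
      using w by (simp add: row_gram_mult stresses_on_def supported_on_def)
    then show "row_gram E B x *v w = 0"
      by (simp add: vec_eq_iff)
  qed
  then show ?thesis
    using subspace_0[OF subspace_stresses_on[of E x B]] by (auto simp: det_nonzero_iff)
qed

text \<open>
  Cramer's rule for the stress with values \<open>s\<close> on the edges outside \<open>B\<close>, multiplied by the
  determinant so that the entries are polynomials in \<open>x\<close>.
\<close>

definition gram_rhs ::
    "'n::finite set set \<Rightarrow> 'n set set \<Rightarrow> (real ^ ('n set)) \<Rightarrow> ('n \<Rightarrow> real ^ 'd::finite) \<Rightarrow> real ^ ('n set)" where
  "gram_rhs E B s x = (\<chi> e. if e \<in> B
     then - (\<Sum>f\<in>E - B. s $ f * (rigidity_matrix E x $ e \<bullet> rigidity_matrix E x $ f)) else 0)"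

definition cramer_stress ::
    "'n::finite set set \<Rightarrow> 'n set set \<Rightarrow> (real ^ ('n set)) \<Rightarrow> ('n \<Rightarrow> real ^ 'd::finite) \<Rightarrow> real ^ ('n set)" where
  "cramer_stress E B s x = (\<chi> e. if e \<in> B
     then det (\<chi> i j. if j = e then gram_rhs E B s x $ i else row_gram E B x $ i $ j)
     else if e \<in> E then det (row_gram E B x) * s $ e else 0)"

lemma cramer_stress_eq:
  assumes "B \<subseteq> E" and y: "row_gram E B x *v y = gram_rhs E B s x"
  shows "cramer_stress E B s x = det (row_gram E B x) *\<^sub>R (\<chi> e. if e \<in> B then y $ e else if e \<in> E then s $ e else 0)"
  using cramer_lemma[of _ "row_gram E B x" y, unfolded y]
  by (auto simp: cramer_stress_def vec_eq_iff)

text \<open>The restriction of \<open>w\<close> to \<open>B\<close> solves the Gram system whose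
  free values are those of \<open>w\<close>, so Cramer's rule returns \<open>w\<close> times the
  determinant.\<close>

lemma cramer_stress_self:
  assumes "B \<subseteq> E" and w: "w \<in> stresses_on E x E"
  shows "cramer_stress E B w x = det (row_gram E B x) *\<^sub>R w"
proof -
  let ?R = "\<lambda>e. rigidity_matrix E x $ e"
  let ?y = "\<chi> e. if e \<in> B then w $ e else 0"
  have "(\<Sum>f\<in>B. w $ f *\<^sub>R ?R f) = - (\<Sum>f\<in>E - B. w $ f *\<^sub>R ?R f)"
    using w sum.subset_diff[OF assms(1), of "\<lambda>f. w $ f *\<^sub>R ?R f"]
    by (auto simp: stresses_on_def supported_vector_matrix_mult eq_neg_iff_add_eq_0 add.commute)
  then have "(\<Sum>f\<in>B. ?y $ f *\<^sub>R ?R f) = - (\<Sum>f\<in>E - B. w $ f *\<^sub>R ?R f)"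
    by (simp cong: sum.cong)
  then have "(row_gram E B x *v ?y) $ e = gram_rhs E B w x $ e" for e
    by (simp only: row_gram_mult) (simp add: gram_rhs_def inner_sum_right)
  then have "row_gram E B x *v ?y = gram_rhs E B w x"
    by (intro vec_eq_iff[THEN iffD2] allI)
  from cramer_stress_eq[OF assms(1) this] show ?thesis
    using w by (auto simp: vec_eq_iff stresses_on_def supported_on_def)
qed

text \<open>The Gram equations make the resultant \<open>z\<close> orthogonal to the rows in
  \<open>B\<close>. These span all rows, so \<open>z\<close> is orthogonal to itself.\<close>

lemma cramer_stress_in_stresses:
  assumes "B \<subseteq> E" "det (row_gram E B x) \<noteq> 0" "row_space E x B = row_space E x E"
  shows "cramer_stress E B s x \<in> stresses_on E x E"
proof -
  let ?R = "\<lambda>e. rigidity_matrix E x $ e"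
  have "surj ((*v) (row_gram E B x))"
    using assms(2) by (metis invertible_det_nz invertible_right_inverse matrix_right_invertible_surjective)
  then obtain y where y: "row_gram E B x *v y = gram_rhs E B s x"
    by (metis surjD)
  define w where "w = (\<chi> e. if e \<in> B then y $ e else if e \<in> E then s $ e else 0)"
  have supp: "w \<in> supported_on E"
    using assms(1) by (auto simp: supported_on_def w_def)
  define z where "z = w v* rigidity_matrix E x"
  have z: "z = (\<Sum>f\<in>B. y $ f *\<^sub>R ?R f) + (\<Sum>f\<in>E - B. s $ f *\<^sub>R ?R f)"
    unfolding z_def supported_vector_matrix_mult[OF supp] sum.subset_diff[OF assms(1) finite]
    by (simp add: w_def)
  have "?R e \<bullet> z = 0" if "e \<in> B" for e
    using arg_cong[OF y, of "\<lambda>v. v $ e"] that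
    by (simp add: row_gram_mult gram_rhs_def z inner_add_right inner_sum_right)
  then have "row_space E x B \<subseteq> {v. orthogonal z v}"
    by (intro row_space_subset subspace_orthogonal_to_vector) (auto simp: orthogonal_def inner_commute)
  moreover have "z \<in> row_space E x B"
    unfolding assms(3) using supp by (auto simp: row_space_def z_def)
  ultimately have "z = 0"
    by (auto simp: orthogonal_def)
  with supp have "w \<in> stresses_on E x E"
    by (simp add: stresses_on_def z_def)
  then show ?thesis
    unfolding cramer_stress_eq[OF assms(1) y] w_def[symmetric]
    by (rule subspace_scale[OF subspace_stresses_on])
qed

section \<open>Stress vectors and stress matrices\<close>

definition stress_matrix :: "real ^ ('n set) \<Rightarrow> real ^ 'n ^ 'n" where
  "stress_matrix w = (\<chi> i j. if i = j then - (\<Sum>k\<in>UNIV - {i}. w $ {i, k}) else w $ {i, j})"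

lemma transpose_stress_matrix: "transpose (stress_matrix w) = stress_matrix w"
  by (auto simp: stress_matrix_def transpose_def vec_eq_iff insert_commute)

lemma stress_matrix_scaleR: "stress_matrix (c *\<^sub>R w) = c *\<^sub>R stress_matrix w"
  by (auto simp: stress_matrix_def vec_eq_iff sum_distrib_left)

lemma stress_matrix_mult:
  fixes y :: "real ^ 'n::finite"
  shows "(stress_matrix w *v y) $ k = (\<Sum>j\<in>UNIV - {k}. w $ {k, j} * (y $ j - y $ k))"
proof -
  have "(stress_matrix w *v y) $ k = stress_matrix w $ k $ k * y $ k +
      (\<Sum>j\<in>UNIV - {k}. stress_matrix w $ k $ j * y $ j)"
    by (simp add: matrix_vector_mult_def sum.remove[of _ k])
  also have "(\<Sum>j\<in>UNIV - {k}. stress_matrix w $ k $ j * y $ j) = (\<Sum>j\<in>UNIV - {k}. w $ {k, j} * y $ j)"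
    by (intro sum.cong) (auto simp: stress_matrix_def)
  also have "stress_matrix w $ k $ k * y $ k = - (\<Sum>j\<in>UNIV - {k}. w $ {k, j} * y $ k)"
    by (simp add: stress_matrix_def sum_distrib_right)
  finally show ?thesis
    by (simp add: right_diff_distrib sum_subtractf)
qed

text \<open>The edges at \<open>k\<close> are regrouped by their other endpoint. The sign appears
  because the rows hold \<open>x k - x l\<close>, while the matrix acts through
  \<open>x l - x k\<close>.\<close>

lemma stress_resultant:
  fixes x :: "'n::finite \<Rightarrow> real ^ 'd::finite"
  assumes E: "simple_graph E" and w: "w \<in> supported_on E"
  shows "(w v* rigidity_matrix E x) $ (k, c) = - (stress_matrix w *v (\<chi> j. x j $ c)) $ k"
proof -
  have "(w v* rigidity_matrix E x) $ (k, c) =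
      (\<Sum>e\<in>{e\<in>E. k \<in> e}. w $ e * (\<Sum>l\<in>e. x k - x l) $ c)"
    unfolding vector_matrix_mult_def rigidity_matrix_def
    by (simp, rule sum.mono_neutral_cong_right) auto
  also have "\<dots> = (\<Sum>e\<in>(\<lambda>l. {k, l}) ` (UNIV - {k}). w $ e * (\<Sum>l\<in>e. x k - x l) $ c)"
  proof (rule sum.mono_neutral_left)
    show "{e \<in> E. k \<in> e} \<subseteq> (\<lambda>l. {k, l}) ` (UNIV - {k})"
    proof
      fix e assume "e \<in> {e \<in> E. k \<in> e}"
      then obtain a b where "e = {a, b}" "a \<noteq> b" "k = a \<or> k = b"
        using E unfolding simple_graph_def card_2_iff by blast
      then show "e \<in> (\<lambda>l. {k, l}) ` (UNIV - {k})"
        by (auto simp: insert_commute)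
    qed
  qed (use w in \<open>auto simp: supported_on_def\<close>)
  also have "\<dots> = (\<Sum>l\<in>UNIV - {k}. w $ {k, l} * (x k $ c - x l $ c))"
    by (subst sum.reindex) (auto simp: inj_on_def doubleton_eq_iff intro!: sum.cong)
  also have "\<dots> = - (stress_matrix w *v (\<chi> j. x j $ c)) $ k"
    unfolding stress_matrix_mult sum_negf[symmetric] by (intro sum.cong) (auto simp: algebra_simps)
  finally show ?thesis .
qed

text \<open>Constants are killed because only differences enter \<open>stress_matrix_mult\<close>,
  and coordinates are killed by equilibrium; affine functions combine the two.\<close>

lemma stress_matrix_homogenize:
  fixes x :: "'n::finite \<Rightarrow> real ^ 'd::finite"
  assumes E: "simple_graph E" and w: "w \<in> stresses_on E x E"
  shows "stress_matrix w *v (\<chi> j. a \<bullet> homogenize (x j)) = 0"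
proof -
  have 0: "(stress_matrix w *v (\<chi> j. x j $ c)) $ k = 0" for k c
    using w stress_resultant[OF E, of w x k c] by (simp add: stresses_on_def)
  have h: "a \<bullet> homogenize (x j) = a $ None + (\<Sum>c\<in>UNIV. a $ Some c * x j $ c)" for j
    unfolding inner_homogenize by (simp add: inner_vec_def)
  have "(stress_matrix w *v (\<chi> j. a \<bullet> homogenize (x j))) $ k =
     (\<Sum>c\<in>UNIV. a $ Some c * (stress_matrix w *v (\<chi> j. x j $ c)) $ k)" for k
    unfolding stress_matrix_mult h
    by (simp add: sum_distrib_left sum_subtractf[symmetric] sum.swap[of _ _ "UNIV - {k}"] algebra_simps)
  then show ?thesis
    by (simp add: vec_eq_iff 0)
qed

lemma stress_of_matrix:
  fixes x :: "'n::finite \<Rightarrow> real ^ 'd::finite"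
  assumes E: "simple_graph E" and \<Omega>: "equilibrium_stress_matrix E x \<Omega>"
  obtains w where "w \<in> stresses_on E x E" "stress_matrix w = \<Omega>"
proof -
  \<comment> \<open>Each edge meets both symmetric entries \<open>\<Omega> $ i $ j\<close> and
    \<open>\<Omega> $ j $ i\<close>, hence the factor 1/2.\<close>
  define w where "w = (\<chi> e. if e \<in> E then (\<Sum>i\<in>e. \<Sum>j\<in>e - {i}. \<Omega> $ i $ j) / 2 else 0)"
  have sym: "\<Omega> $ i $ j = \<Omega> $ j $ i" for i j
    using \<Omega> by (simp add: equilibrium_stress_matrix_def transpose_def vec_eq_iff)
  have w_ij: "w $ {i, j} = \<Omega> $ i $ j" if "i \<noteq> j" for i j
  proof (cases "{i, j} \<in> E")
    case True
    have "{i, j} - {i} = {j}" "{i, j} - {j} = {i}" using that by auto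
    then show ?thesis
      using True that by (simp add: w_def sym[of j i])
  next
    case False
    then show ?thesis
      using \<Omega> that by (simp add: w_def equilibrium_stress_matrix_def)
  qed
  have diag: "\<Omega> $ i $ i = - (\<Sum>k\<in>UNIV - {i}. \<Omega> $ i $ k)" for i
  proof -
    have "(\<Sum>k\<in>UNIV. \<Omega> $ i $ k) = (\<Omega> *v (\<chi> i. 1)) $ i"
      by (simp add: matrix_vector_mult_def)
    also have "\<dots> = 0"
      using \<Omega> by (simp add: equilibrium_stress_matrix_def)
    finally show ?thesis
      by (simp add: sum.remove[of UNIV i] eq_neg_iff_add_eq_0)
  qed
  have eq: "stress_matrix w = \<Omega>"
    by (auto simp: stress_matrix_def vec_eq_iff w_ij diag)
  have supp: "w \<in> supported_on E"
    by (simp add: w_def supported_on_def)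
  have "(\<Omega> *v (\<chi> j. x j $ c)) $ k = (\<Sum>j\<in>UNIV. \<Omega> $ k $ j *\<^sub>R x j) $ c" for k c
    by (simp add: matrix_vector_mult_def)
  then have "w v* rigidity_matrix E x = 0"
    using \<Omega> stress_resultant[OF E supp, of x]
    by (simp add: vec_eq_iff eq equilibrium_stress_matrix_def split_paired_all)
  with supp eq that show thesis
    by (simp add: stresses_on_def)
qed

section \<open>A determinant test for the kernel of a stress matrix\<close>

definition shifted_matrix :: "real \<Rightarrow> ('n \<Rightarrow> real ^ 'k) \<Rightarrow> real ^ 'n ^ 'n \<Rightarrow> real ^ 'n ^ 'n" where
  "shifted_matrix c h \<Omega> = (\<chi> i j. \<Omega> $ i $ j + c * (h i \<bullet> h j))"

lemma shifted_matrix_mult: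
  "(shifted_matrix c h \<Omega> *v y) $ i = (\<Omega> *v y) $ i + c * (h i \<bullet> (\<Sum>j\<in>UNIV. y $ j *\<^sub>R h j))"
  by (simp add: shifted_matrix_def matrix_vector_mult_def inner_sum_right sum.distrib
      sum_distrib_left algebra_simps)

text \<open>
  Adding the Gram matrix of the points moves the kernel away exactly when the kernel consists of
  the affine functions of the configuration only.
\<close>

lemma det_shifted_matrix_nonzero:
  fixes h :: "'n::finite \<Rightarrow> real ^ 'k::finite"
  assumes sym: "transpose \<Omega> = \<Omega>" and ker: "\<And>a. \<Omega> *v (\<chi> j. a \<bullet> h j) = 0"
    and rank: "rank \<Omega> + CARD('k) = CARD('n)"
    and span: "\<And>v. \<forall>j. v \<bullet> h j = 0 \<Longrightarrow> v = 0" and "c \<noteq> 0"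
  shows "det (shifted_matrix c h (c *\<^sub>R \<Omega>)) \<noteq> 0"
  unfolding det_nonzero_iff
proof (intro allI impI)
  fix y assume y: "shifted_matrix c h (c *\<^sub>R \<Omega>) *v y = 0"
  define u where "u = (\<Sum>j\<in>UNIV. y $ j *\<^sub>R h j)"
  have "(c *\<^sub>R \<Omega> *v y) $ i + c * (h i \<bullet> u) = 0" for i
    using shifted_matrix_mult[of c h "c *\<^sub>R \<Omega>" y i] y by (simp add: u_def)
  then have eq: "(\<Omega> *v y) $ i = - (h i \<bullet> u)" for i
    using \<open>c \<noteq> 0\<close> by (simp add: scaleR_matrix_vector_assoc[symmetric] eq_neg_iff_add_eq_0
        distrib_left[symmetric])
  \<comment> \<open>The right side is 0 by \<open>ker\<close>, while \<open>eq\<close> turns the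
    left side into minus a sum of squares.\<close>
  have "(\<Omega> *v y) \<bullet> (\<chi> j. u \<bullet> h j) = y \<bullet> (\<Omega> *v (\<chi> j. u \<bullet> h j))"
    using sym by (metis dot_lmul_matrix inner_commute transpose_matrix_vector)
  then have "(\<Sum>j\<in>UNIV. (u \<bullet> h j)\<^sup>2) = 0"
    by (simp add: ker inner_vec_def[of "\<Omega> *v y"] eq power2_eq_square inner_commute sum_negf)
  then have "u = 0"
    by (intro span) (simp add: sum_nonneg_eq_0_iff)
  then have "(\<Omega> *v y) $ i = 0" for i
    by (simp add: eq)
  then have \<Omega>y: "\<Omega> *v y = 0"
    by (simp add: vec_eq_iff)
  let ?f = "\<lambda>a. \<chi> j. a \<bullet> h j" and ?K = "{y. \<Omega> *v y = 0}"
  have lin: "linear ?f"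
    by (rule linearI) (simp_all add: vec_eq_iff inner_add_left)
  have "inj ?f"
    unfolding linear_injective_0[OF lin] using span by (auto simp: vec_eq_iff)
  then have "dim (range ?f) = CARD('k)"
    by (subst dim_image_eq[OF lin]) auto
  moreover have "dim ?K = CARD('k)"
    using dim_kernel_add_dim_image[OF matrix_vector_mul_linear[of \<Omega>] subspace_UNIV] rank
    by (simp add: rank_dim_range)
  moreover have "subspace (range ?f)"
    by (rule linear_subspace_image[OF lin subspace_UNIV])
  moreover have "subspace ?K"
    by (rule linear_subspace_kernel[OF matrix_vector_mul_linear])
  \<comment> \<open>Both spaces have dimension \<open>CARD('k)\<close>, so \<open>y\<close> is given
    by some \<open>a\<close>; then \<open>a \<bullet> u = 0\<close> is again a sum of
    squares.\<close>
  ultimately have "range ?f = ?K"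
    using ker by (intro subspace_dim_equal) auto
  with \<Omega>y obtain a where a: "y = ?f a" by blast
  have "a \<bullet> u = (\<Sum>j\<in>UNIV. (a \<bullet> h j)\<^sup>2)"
    by (simp add: u_def a inner_sum_right power2_eq_square)
  then have "a \<bullet> h j = 0" for j
    using \<open>u = 0\<close> by (simp add: sum_nonneg_eq_0_iff)
  then show "y = 0"
    by (simp add: a vec_eq_iff)
qed

text \<open>Subtract from \<open>y\<close> the affine function with the same moments, found by
  inverting the moment matrix. The difference is killed by \<open>\<Omega>\<close> and by the Gram
  term, hence is 0.\<close>

lemma stress_kernel_affine:
  fixes h :: "'n::finite \<Rightarrow> real ^ 'k::finite"
  assumes ker: "\<And>a. \<Omega> *v (\<chi> j. a \<bullet> h j) = 0"
    and span: "\<And>v. \<forall>j. v \<bullet> h j = 0 \<Longrightarrow> v = 0"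
    and det: "det (shifted_matrix c h \<Omega>) \<noteq> 0"
    and y: "\<Omega> *v y = 0"
  obtains a where "\<And>j. y $ j = a \<bullet> h j"
proof -
  have "det (moment_matrix h UNIV) \<noteq> 0"
    using span by (simp add: det_moment_matrix)
  then have "surj ((*v) (moment_matrix h UNIV))"
    by (metis invertible_det_nz invertible_right_inverse matrix_right_invertible_surjective)
  then obtain a where a: "moment_matrix h UNIV *v a = (\<Sum>j\<in>UNIV. y $ j *\<^sub>R h j)"
    by (metis surjD)
  define z where "z = y - (\<chi> j. a \<bullet> h j)"
  have "\<Omega> *v z = 0"
    by (simp add: z_def matrix_vector_mult_diff_distrib ker y)
  moreover have "(\<Sum>j\<in>UNIV. z $ j *\<^sub>R h j) = 0"
    using a by (simp add: z_def moment_matrix_mult scaleR_diff_left sum_subtractf)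
  ultimately have "shifted_matrix c h \<Omega> *v z = 0"
    by (simp add: vec_eq_iff[of "shifted_matrix c h \<Omega> *v z"] shifted_matrix_mult)
  then have "z = 0"
    using det by (simp add: det_nonzero_iff)
  then have "y $ j = a \<bullet> h j" for j
    by (simp add: z_def)
  then show thesis by (rule that)
qed

section \<open>Polynomial functions of a configuration\<close>

definition config_polyfun :: "(('n \<Rightarrow> real ^ 'd) \<Rightarrow> real) \<Rightarrow> bool" where
  "config_polyfun F \<longleftrightarrow> rat_polyfun (\<lambda>y. F (\<lambda>i. \<chi> c. y (i, c)))"

lemma config_polyfun_coordinate: "config_polyfun (\<lambda>x. x i $ c)"
  by (simp add: config_polyfun_def rat_polyfun_variable)

lemma config_polyfun_nonzero:
  fixes p q :: "'n \<Rightarrow> real ^ 'd::finite"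
  assumes "generic_configuration p" "config_polyfun F" "F q \<noteq> 0"
  shows "F p \<noteq> 0"
  using rat_polyfun_nonzero[of "\<lambda>(i, c). p i $ c" "\<lambda>y. F (\<lambda>i. \<chi> c. y (i, c))" "\<lambda>(i, c). q i $ c"] assms
  by (simp add: generic_configuration_def config_polyfun_def)

lemma config_polyfun_ops:
  shows "a \<in> \<rat> \<Longrightarrow> config_polyfun (\<lambda>x. a)"
    and "config_polyfun F \<Longrightarrow> config_polyfun G \<Longrightarrow> config_polyfun (\<lambda>x. F x + G x)"
    and "config_polyfun F \<Longrightarrow> config_polyfun G \<Longrightarrow> config_polyfun (\<lambda>x. F x - G x)"
    and "config_polyfun F \<Longrightarrow> config_polyfun G \<Longrightarrow> config_polyfun (\<lambda>x. F x * G x)"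
    and "config_polyfun F \<Longrightarrow> config_polyfun (\<lambda>x. - F x)"
    and "(\<And>i. i \<in> I \<Longrightarrow> config_polyfun (H i)) \<Longrightarrow> config_polyfun (\<lambda>x. \<Sum>i\<in>I. H i x)"
    and "(b \<Longrightarrow> config_polyfun F) \<Longrightarrow> (\<not> b \<Longrightarrow> config_polyfun G) \<Longrightarrow> config_polyfun (\<lambda>x. if b then F x else G x)"
    and "(\<And>i j. config_polyfun (\<lambda>x. M x $ i $ j)) \<Longrightarrow> config_polyfun (\<lambda>x. det (M x))"
  unfolding config_polyfun_def
  by (fact rat_polyfun_const rat_polyfun_add rat_polyfun_diff rat_polyfun_mult rat_polyfun_uminus
      rat_polyfun_sum rat_polyfun_if rat_polyfun_det)+

lemma config_polyfun_homogenize: "config_polyfun (\<lambda>x. homogenize (x i) $ c)"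
  by (cases c) (auto simp: homogenize_def intro: config_polyfun_ops config_polyfun_coordinate)

lemma config_polyfun_rigidity_matrix: "config_polyfun (\<lambda>x. rigidity_matrix E x $ e $ k)"
  by (cases k) (auto simp: rigidity_matrix_def intro!: config_polyfun_ops config_polyfun_coordinate)

lemma config_polyfun_row_gram: "config_polyfun (\<lambda>x. row_gram E B x $ e $ f)"
  by (auto simp: row_gram_def inner_vec_def
      intro!: config_polyfun_ops config_polyfun_rigidity_matrix)

lemma config_polyfun_det_row_gram: "config_polyfun (\<lambda>x. det (row_gram E B x))"
  by (rule config_polyfun_ops(8)) (rule config_polyfun_row_gram)

lemma config_polyfun_cramer_stress:
  assumes "\<And>e. s $ e \<in> \<rat>"
  shows "config_polyfun (\<lambda>x. cramer_stress E B s x $ e)"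
proof -
  have rhs: "config_polyfun (\<lambda>x. gram_rhs E B s x $ i)" for i
    using assms by (auto simp: gram_rhs_def inner_vec_def
        intro!: config_polyfun_ops config_polyfun_rigidity_matrix)
  show ?thesis
    using assms by (auto simp: cramer_stress_def
        intro!: config_polyfun_ops config_polyfun_row_gram rhs)
qed

lemma config_polyfun_shifted_stress:
  assumes "\<And>e. s $ e \<in> \<rat>"
  shows "config_polyfun (\<lambda>x. det (shifted_matrix (det (row_gram E B x)) (\<lambda>j. homogenize (x j))
    (stress_matrix (cramer_stress E B s x))))"
  using assms by (auto simp: shifted_matrix_def stress_matrix_def inner_vec_def
      intro!: config_polyfun_ops config_polyfun_row_gram config_polyfun_cramer_stress
        config_polyfun_homogenize)

lemma config_polyfun_moment_matrix:
  "config_polyfun (\<lambda>x. det (moment_matrix (\<lambda>j. homogenize (x j)) S))"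
  by (auto simp: moment_matrix_def intro!: config_polyfun_ops config_polyfun_homogenize)

text \<open>The nonvanishing set is open and rational points are dense. Rational free values turn
  the Cramer stress into a rational polynomial in the configuration.\<close>

lemma rational_point_nonzero:
  fixes F :: "real ^ 'k::finite \<Rightarrow> real"
  assumes "continuous_on UNIV F" "F s \<noteq> 0"
  obtains r where "\<And>i. r $ i \<in> \<rat>" "F r \<noteq> 0"
proof -
  let ?Q = "\<Union>f\<in>Basis \<rightarrow> \<rat>. {\<Sum>i\<in>Basis. f i *\<^sub>R i :: real ^ 'k}"
  have "open {r. F r \<noteq> 0}"
    using assms(1) by (intro open_Collect_neq) auto
  moreover have "s \<in> closure ?Q"
    by (simp add: closure_rational_coordinates)
  ultimately obtain r where "r \<in> ?Q" "F r \<noteq> 0"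
    using assms(2) unfolding closure_iff_nhds_not_empty by blast
  moreover from this obtain f where f: "f \<in> Basis \<rightarrow> \<rat>" "r = (\<Sum>i\<in>Basis. f i *\<^sub>R i)" by auto
  have "r $ i = f (axis i 1)" for i
    using inner_sum_left_Basis[of "axis i 1 :: real ^ 'k" f] f(2)
    by (simp add: axis_in_Basis_iff cart_eq_inner_axis)
  then have "r $ i \<in> \<rat>" for i
    using f(1) by (auto simp: Pi_iff axis_in_Basis_iff)
  ultimately show thesis using that by blast
qed

lemma continuous_on_det:
  fixes M :: "'a::topological_space \<Rightarrow> real ^ 'k ^ 'k"
  assumes "\<And>i j. continuous_on S (\<lambda>s. M s $ i $ j)"
  shows "continuous_on S (\<lambda>s. det (M s))"
  unfolding det_def by (intro continuous_intros assms)

lemma continuous_on_cramer_stress: "continuous_on S (\<lambda>s. cramer_stress E B s x $ e)"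
proof -
  have "continuous_on S (\<lambda>s. gram_rhs E B s x $ i)" for i
    by (cases "i \<in> B") (auto simp: gram_rhs_def intro!: continuous_intros)
  then have "continuous_on S (\<lambda>s. if j = e then gram_rhs E B s x $ i else row_gram E B x $ i $ j)"
    for i j by (cases "j = e") auto
  then show ?thesis
    by (cases "e \<in> B"; cases "e \<in> E")
      (auto simp: cramer_stress_def intro!: continuous_intros continuous_on_det)
qed

lemma continuous_on_shifted_stress:
  "continuous_on S (\<lambda>s. det (shifted_matrix c h (stress_matrix (cramer_stress E B s x))))"
proof (rule continuous_on_det)
  fix i j
  show "continuous_on S (\<lambda>s. shifted_matrix c h (stress_matrix (cramer_stress E B s x)) $ i $ j)"
    by (cases "i = j") (auto simp: shifted_matrix_def stress_matrix_def
        intro!: continuous_intros continuous_on_cramer_stress)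
qed

section \<open>Frameworks equivalent to a generic one\<close>

lemma generic_cokernel_subset:
  fixes p q :: "'n::finite \<Rightarrow> real ^ 'd::finite"
  assumes E: "simple_graph E" and p: "generic_configuration p" and eq: "equivalent_frameworks E p q"
  shows "rigidity_cokernel E q \<subseteq> rigidity_cokernel E p"
proof
  fix w assume w: "w \<in> rigidity_cokernel E q"
  have "(w v* rigidity_matrix E p) \<bullet> v = 0" for v
  proof -
    obtain D :: "real \<Rightarrow> real" where D_diff: "\<And>x y. D (x - y) = D x - D y"
      and D_mult: "\<And>x y. D (x * y) = x * D y + D x * y" and D_0: "D 0 = 0"
      and "\<And>ic. D ((\<lambda>(i, c). p i $ c) ic) = v $ ic"
      using alg_independent_derivation[of "\<lambda>(i, c). p i $ c" "\<lambda>ic. v $ ic"] p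
      unfolding generic_configuration_def by metis
    then have D_p: "D (p i $ c) = v $ (i, c)" for i c
      by auto
    have D_add: "D (x + y) = D x + D y" for x y
      using D_diff[of x "0 - y"] D_diff[of 0 y] by (simp add: D_0)
    have D_sum: "D (\<Sum>i\<in>I. f i) = (\<Sum>i\<in>I. D (f i))" for f and I :: "'d set"
      by (induction I rule: infinite_finite_induct) (auto simp: D_0 D_add)
    define v' where "v' k = (\<chi> c. v $ (k, c))" for k
    \<comment> \<open>The velocity that \<open>D\<close> induces on \<open>q\<close>. As
      \<open>D\<close> acts on all reals, it applies whatever the dependence of \<open>q\<close> on
      \<open>p\<close>.\<close>
    define u where "u k = (\<chi> c. D (q k $ c))" for k
    have D_norm: "D ((x - y) \<bullet> (x - y)) = 2 * ((x - y) \<bullet> ((\<chi> c. D (x $ c)) - (\<chi> c. D (y $ c))))"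
      for x y :: "real ^ 'd"
      by (simp add: inner_vec_def D_sum D_mult D_diff sum_distrib_left)
    have "(rigidity_matrix E p *v v) $ e = (rigidity_matrix E q *v vec_lambda (\<lambda>(k, c). u k $ c)) $ e" for e
    proof (cases "e \<in> E")
      case True
      then obtain i j where ij: "e = {i, j}" "i \<noteq> j"
        using E by (auto simp: simple_graph_def card_2_iff)
      have "norm (p j - p i) = norm (q j - q i)"
        using eq True ij unfolding equivalent_frameworks_def by (metis norm_minus_commute)
      then have "(p j - p i) \<bullet> (p j - p i) = (q j - q i) \<bullet> (q j - q i)"
        by (simp add: dot_square_norm)
      then have "(p j - p i) \<bullet> (v' j - v' i) = (q j - q i) \<bullet> (u j - u i)"
        using D_norm[of "p j" "p i"] D_norm[of "q j" "q i"] by (simp add: v'_def u_def D_p)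
      moreover have "v = vec_lambda (\<lambda>(k, c). v' k $ c)"
        by (simp add: v'_def vec_eq_iff split_paired_all)
      ultimately show ?thesis
        using rigidity_matrix_mult[of i j E p v'] rigidity_matrix_mult[of i j E q u] True ij by simp
    next
      case False
      then show ?thesis
        by (simp add: rigidity_matrix_def matrix_vector_mult_def split_beta)
    qed
    then have "rigidity_matrix E p *v v = rigidity_matrix E q *v vec_lambda (\<lambda>(k, c). u k $ c)"
      by (intro vec_eq_iff[THEN iffD2] allI)
    then have "(w v* rigidity_matrix E p) \<bullet> v = (w v* rigidity_matrix E q) \<bullet> vec_lambda (\<lambda>(k, c). u k $ c)"
      by (simp add: dot_lmul_matrix)
    then show ?thesis
      using w by (simp add: rigidity_cokernel_def)
  qed
  \<comment> \<open>Tested against itself, the vector has norm 0.\<close>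
  from this[of "w v* rigidity_matrix E p"] show "w \<in> rigidity_cokernel E p"
    using w by (simp add: rigidity_cokernel_def)
qed

text \<open>With fewer than \<open>k\<close> neighbours, deleting them would isolate
  \<open>i\<close> from a remaining vertex. \<open>S\<close> consists of \<open>i\<close> and
  \<open>k\<close> neighbours: for k = d, the d + 1 points that can affinely span.\<close>

lemma k_connected_degree:
  fixes E :: "'n::finite set set"
  assumes E: "simple_graph E" and k: "k_connected (Suc k) E"
  shows "\<exists>S. i \<in> S \<and> card S = Suc k \<and> (\<forall>j\<in>S. j \<noteq> i \<longrightarrow> {i, j} \<in> E)"
proof -
  define N where "N = {j. j \<noteq> i \<and> {i, j} \<in> E}"
  have "k \<le> card N"
  proof (rule ccontr)
    assume "\<not> k \<le> card N"
    then have conn: "connected_without E N" and "card (insert i N) < CARD('n)"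
      using k by (auto simp: k_connected_def N_def)
    then obtain v where v: "v \<notin> insert i N"
      by (metis UNIV_eq_I less_irrefl)
    with conn have "(i, v) \<in> {(x, y). x \<notin> N \<and> y \<notin> N \<and> {x, y} \<in> E}\<^sup>*"
      by (auto simp: connected_without_def N_def)
    then show False
    proof (cases rule: converse_rtranclE)
      case base
      with v show False by simp
    next
      case (step y)
      then have "{i, y} \<in> E" "y \<notin> N" by auto
      moreover from this E have "y \<noteq> i"
        by (force simp: simple_graph_def)
      ultimately show False by (simp add: N_def)
    qed
  qed
  then obtain T where T: "T \<subseteq> N" "card T = k" "finite T"
    by (rule obtain_subset_with_card_n)
  then have "i \<notin> T" by (auto simp: N_def)
  then show ?thesis
    using T by (intro exI[of _ "insert i T"]) (auto simp: N_def)
qed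

definition affine_form :: "real \<Rightarrow> real ^ 'd \<Rightarrow> real ^ 'd option" where
  "affine_form s b = (\<chi> c. case c of None \<Rightarrow> s | Some c \<Rightarrow> b $ c)"

lemma affine_form_simps [simp]: "affine_form s b $ None = s" "affine_form s b $ Some c = b $ c"
  by (simp_all add: affine_form_def)

lemma inner_affine_form: "affine_form s b \<bullet> homogenize v = s + b \<bullet> v"
  by (simp add: inner_homogenize)

lemma affine_form_eq_0_iff: "affine_form s b = 0 \<longleftrightarrow> s = 0 \<and> b = 0"
  by (auto simp: vec_eq_iff affine_form_def split: option.split)

text \<open>
  The edge directions do not lie on a conic at infinity, by an argument of Alfakih and Ye: if the
  form \<open>A\<^sup>T A - 1\<close> vanishes on all edge directions, then \<open>\<Omega>\<close> kills the vector of its values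
  at the points, so these values are affine in the points.
\<close>

lemma equivalent_affine_image_congruent:
  fixes p q :: "'n::finite \<Rightarrow> real ^ 'd::finite"
  assumes E: "simple_graph E" and w: "w \<in> stresses_on E p E"
    and ker: "\<And>y. stress_matrix w *v y = 0 \<Longrightarrow> \<exists>a. \<forall>j. y $ j = a \<bullet> homogenize (p j)"
    and nbhd: "\<And>i. \<exists>S. i \<in> S \<and> (\<forall>j\<in>S. j \<noteq> i \<longrightarrow> {i, j} \<in> E) \<and>
      (\<forall>v. (\<forall>j\<in>S. v \<bullet> homogenize (p j) = 0) \<longrightarrow> v = 0)"
    and q: "\<And>j. q j = t + A *v p j" and eq: "equivalent_frameworks E p q"
  shows "congruent_frameworks p q"
proof -
  \<comment> \<open>The quadratic form of \<open>M\<close> measures how \<open>A\<close> changes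
    squared lengths; \<open>A\<close> is orthogonal iff \<open>M = 0\<close>. \<open>B\<close> is
    the bilinear form of \<open>M\<close> at the points.\<close>
  define M where "M = transpose A ** A - mat 1"
  define B where "B i j = (M *v p i) \<bullet> p j" for i j
  have B: "B i j = (A *v p i) \<bullet> (A *v p j) - p i \<bullet> p j" for i j
    by (simp add: B_def M_def matrix_vector_mult_diff_rdistrib inner_diff_left
        matrix_vector_mul_assoc[symmetric] dot_lmul_matrix)
  have edge: "B i i + B j j - 2 * B i j = 0" if "{i, j} \<in> E" for i j
  proof -
    have "norm (p i - p j) = norm (A *v p i - A *v p j)"
      using eq that by (simp add: equivalent_frameworks_def q)
    then have "(p i - p j) \<bullet> (p i - p j) = (A *v p i - A *v p j) \<bullet> (A *v p i - A *v p j)"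
      by (simp add: dot_square_norm)
    then show ?thesis
      by (simp add: B inner_diff_left inner_diff_right inner_commute)
  qed
  have "(stress_matrix w *v (\<chi> j. B j j)) $ k = 0" for k
  proof -
    \<comment> \<open>On an edge, \<open>B j j - B k k = 2 * (B k j - B k k)\<close>, so the
      quadratic function may be replaced by a linear one, which the stress kills.\<close>
    have "(stress_matrix w *v (\<chi> j. B j j)) $ k = 2 * (stress_matrix w *v (\<chi> j. B k j)) $ k"
      unfolding stress_matrix_mult sum_distrib_left
    proof (rule sum.cong)
      fix j
      show "w $ {k, j} * ((\<chi> j. B j j) $ j - (\<chi> j. B j j) $ k) =
          2 * (w $ {k, j} * ((\<chi> j. B k j) $ j - (\<chi> j. B k j) $ k))"
        using edge[of k j] w by (cases "{k, j} \<in> E") (auto simp: stresses_on_def supported_on_def)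
    qed simp
    also have "(\<chi> j. B k j) = (\<chi> j. affine_form 0 (M *v p k) \<bullet> homogenize (p j))"
      by (simp add: inner_affine_form B_def)
    finally show ?thesis
      by (simp add: stress_matrix_homogenize[OF E w])
  qed
  then obtain a where a: "\<And>j. B j j = a \<bullet> homogenize (p j)"
    using ker[of "\<chi> j. B j j"] by (auto simp: vec_eq_iff)
  define a' where "a' = (\<chi> c. a $ Some c)"
  have Mp: "2 *\<^sub>R (M *v p i) = a'" for i
  proof -
    obtain S where S: "i \<in> S" "\<And>j. j \<in> S \<Longrightarrow> j \<noteq> i \<Longrightarrow> {i, j} \<in> E"
      "\<And>v. \<forall>j\<in>S. v \<bullet> homogenize (p j) = 0 \<Longrightarrow> v = 0"
      using nbhd[of i] by blast
    \<comment> \<open>Since \<open>B j j\<close> is affine in \<open>p j\<close>, so is the edge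
      expression for fixed \<open>i\<close>. It vanishes at the neighbours in \<open>S\<close> and
      trivially at \<open>i\<close>, and these points span.\<close>
    have *: "affine_form (B i i + a $ None) (a' - 2 *\<^sub>R (M *v p i)) \<bullet> homogenize (p j) =
        B i i + B j j - 2 * B i j" for j
      using a[of j] unfolding inner_affine_form
      by (simp add: inner_homogenize a'_def[symmetric] B_def inner_diff_left)
    have "B i i + B j j - 2 * B i j = 0" if "j \<in> S" for j
      using edge[of i j] S(2)[OF that] by (cases "j = i") simp_all
    then have "affine_form (B i i + a $ None) (a' - 2 *\<^sub>R (M *v p i)) = 0"
      by (intro S(3) ballI) (simp only: *)
    then show ?thesis
      by (simp add: affine_form_eq_0_iff)
  qed
  \<comment> \<open>\<open>M *v p j\<close> is the same for all \<open>j\<close>, so each row of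
    \<open>M\<close> gives an affine function vanishing at every point. Any vertex provides a
    spanning set.\<close>
  have "M $ c = 0" for c
  proof -
    obtain S where S: "\<And>v. \<forall>j\<in>S. v \<bullet> homogenize (p j) = 0 \<Longrightarrow> v = 0"
      using nbhd[of undefined] by blast
    have "affine_form (- a' $ c) (2 *\<^sub>R M $ c) \<bullet> homogenize (p j) = 0" for j
      using arg_cong[OF Mp[of j], of "\<lambda>v. v $ c"]
      by (simp add: inner_affine_form matrix_vector_mul_component)
    then show ?thesis
      using S[of "affine_form (- a' $ c) (2 *\<^sub>R M $ c)"] by (simp add: affine_form_eq_0_iff)
  qed
  then have "transpose A ** A = mat 1"
    by (simp add: M_def vec_eq_iff)
  then have "orthogonal_transformation ((*v) A)"
    by (simp add: orthogonal_transformation_matrix orthogonal_matrix matrix_of_matrix_vector_mul)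
  then have "euclidean_motion (\<lambda>v. t + A *v v)"
    by (auto simp: euclidean_motion_def)
  then show ?thesis
    using q unfolding congruent_frameworks_def by blast
qed

theorem proposition7p9:
  fixes E :: "'n::finite set set"
  assumes "simple_graph E"
    and "k_connected (CARD('d::finite) + 1) E"
    and "\<not> generically_globally_rigid TYPE('d) E"
  shows "stressed_corank TYPE('d) E > graph_corank TYPE('d) E"
proof (rule ccontr)
  note E = assms(1)
  let ?P = "{x :: 'n \<Rightarrow> real ^ 'd. gstressable E x}"
  assume "\<not> ?thesis"
  then have le: "stressed_corank TYPE('d) E \<le> enat (framework_corank E x)" for x :: "'n \<Rightarrow> real ^ 'd"
    unfolding graph_corank_def not_less by (rule order_trans) (rule INF_lower, simp)
  \<comment> \<open>Over the empty set the infimum would be \<infinity>, but \<open>le\<close>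
    bounds it by a natural number.\<close>
  have "?P \<noteq> {}"
  proof
    assume empty: "?P = {}"
    show False
      using le unfolding stressed_corank_def empty by (simp add: top_enat_def)
  qed
  then obtain z :: "'n \<Rightarrow> real ^ 'd" where "gstressable E z" by blast
  then obtain x :: "'n \<Rightarrow> real ^ 'd" where x: "gstressable E x"
    and least: "\<And>y :: 'n \<Rightarrow> real ^ 'd. gstressable E y \<Longrightarrow> framework_corank E x \<le> framework_corank E y"
    using exists_least_lemma by (metis arg_min_nat_lemma)
  have "enat (framework_corank E x) \<le> stressed_corank TYPE('d) E"
    unfolding stressed_corank_def by (intro INF_greatest) (simp add: least)
  then have x_min: "framework_corank E x \<le> framework_corank E y" for y :: "'n \<Rightarrow> real ^ 'd"
    using le[of y] by (metis enat_ord_simps(1) order_trans)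
  have gp: "affine_general_position x"
    using x by (simp add: gstressable_def)
  obtain \<Omega>0 where \<Omega>0: "equilibrium_stress_matrix E x \<Omega>0"
      "int (rank \<Omega>0) = int CARD('n) - int CARD('d) - 1"
    using x by (auto simp: gstressable_def)
  then obtain w0 where w0: "w0 \<in> stresses_on E x E" "stress_matrix w0 = \<Omega>0"
    using stress_of_matrix[OF E] by blast
  obtain S0 :: "'n set" where S0: "card S0 = CARD('d) + 1"
    using assms(2) obtain_subset_with_card_n[of "CARD('d) + 1" "UNIV :: 'n set"]
    by (auto simp: k_connected_def)
  obtain B where B: "B \<subseteq> E" "stresses_on E x B = {0}" "row_space E x B = row_space E x E"
    by (rule row_basis_exists)
  then have c0: "det (row_gram E B x) \<noteq> 0"
    by (simp add: det_row_gram)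
  \<comment> \<open>With free values \<open>w0\<close>, the Cramer stress is the determinant times
    \<open>w0\<close>; the Gram term carries the same factor.\<close>
  have "det (shifted_matrix (det (row_gram E B x)) (\<lambda>j. homogenize (x j))
      (stress_matrix (cramer_stress E B w0 x))) \<noteq> 0"
    unfolding cramer_stress_self[OF B(1) w0(1)] stress_matrix_scaleR
  proof (rule det_shifted_matrix_nonzero)
    show "rank (stress_matrix w0) + CARD('d option) = CARD('n)"
      using \<Omega>0(2) by (simp add: w0(2) card_UNIV_option)
    show "v = 0" if "\<forall>j. v \<bullet> homogenize (x j) = 0" for v
      using affine_general_position_span[OF gp S0] that by blast
  qed (simp_all add: transpose_stress_matrix stress_matrix_homogenize[OF E w0(1)] c0)
  then obtain r where r: "\<And>e. r $ e \<in> \<rat>" and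
    det_x: "det (shifted_matrix (det (row_gram E B x)) (\<lambda>j. homogenize (x j))
      (stress_matrix (cramer_stress E B r x))) \<noteq> 0"
    using rational_point_nonzero[OF continuous_on_shifted_stress] by metis
  obtain p q :: "'n \<Rightarrow> real ^ 'd" where p: "generic_configuration p"
    and eq: "equivalent_frameworks E p q" and "\<not> congruent_frameworks p q"
    using assms(3) by (auto simp: generically_globally_rigid_def globally_rigid_def)
  \<comment> \<open>Affine spanning passes from \<open>x\<close> to \<open>p\<close> through the
    moment determinant.\<close>
  have span_p: "v = 0" if "card S = CARD('d) + 1" "\<forall>j\<in>S. v \<bullet> homogenize (p j) = 0" for S v
  proof -
    have "det (moment_matrix (\<lambda>j. homogenize (x j)) S) \<noteq> 0"
      using affine_general_position_span[OF gp that(1)] by (simp add: det_moment_matrix)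
    then have "det (moment_matrix (\<lambda>j. homogenize (p j)) S) \<noteq> 0"
      by (rule config_polyfun_nonzero[OF p config_polyfun_moment_matrix])
    with that(2) show ?thesis
      by (simp add: det_moment_matrix)
  qed
  have det_p: "det (row_gram E B p) \<noteq> 0"
    by (rule config_polyfun_nonzero[OF p config_polyfun_det_row_gram c0])
  \<comment> \<open>The rows in \<open>B\<close> stay independent at \<open>p\<close>, so the rank
    there is at least that at \<open>x\<close>; minimality of the corank of \<open>x\<close> gives
    the converse. Hence \<open>B\<close> is a row basis at \<open>p\<close> too.\<close>
  then have "dim (row_space E p B) = dim (row_space E x B)"
    using dim_stresses_add_dim_rows[of E p B] dim_stresses_add_dim_rows[of E x B] B(2)
    by (simp add: det_row_gram)
  moreover have "dim (stresses_on E x E) \<le> dim (stresses_on E p E)"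
    using x_min[of p] by (simp add: framework_corank_def rigidity_cokernel_eq)
  moreover note dim_stresses_add_dim_rows[of E x E] dim_stresses_add_dim_rows[of E p E]
  moreover have "dim (row_space E p B) \<le> dim (row_space E p E)"
    by (intro dim_subset row_space_mono B(1))
  ultimately have dims: "dim (row_space E p E) \<le> dim (row_space E p B)"
    "dim (stresses_on E p E) = dim (stresses_on E x E)"
    using B(3) by auto
  have "row_space E p B = row_space E p E"
    using dims(1) B(1) by (intro subspace_dim_equal subspace_row_space row_space_mono)
  define w where "w = cramer_stress E B r p"
  have w: "w \<in> stresses_on E p E"
    unfolding w_def by (rule cramer_stress_in_stresses) fact+
  \<comment> \<open>The inclusion is an equality, since the corank of \<open>q\<close> is at least
    that of \<open>x\<close>, which \<open>p\<close> shares.\<close>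
  have "rigidity_cokernel E q = rigidity_cokernel E p"
  proof (rule subspace_dim_equal)
    show "rigidity_cokernel E q \<subseteq> rigidity_cokernel E p"
      by (rule generic_cokernel_subset) fact+
    show "dim (rigidity_cokernel E p) \<le> dim (rigidity_cokernel E q)"
      using x_min[of q] dims(2) by (simp add: framework_corank_def rigidity_cokernel_eq)
  qed (simp_all add: rigidity_cokernel_eq subspace_stresses_on)
  then have wq: "w \<in> stresses_on E q E"
    using w by (simp add: rigidity_cokernel_eq)
  have "det (shifted_matrix (det (row_gram E B p)) (\<lambda>j. homogenize (p j)) (stress_matrix w)) \<noteq> 0"
    unfolding w_def by (rule config_polyfun_nonzero[OF p config_polyfun_shifted_stress[OF r] det_x])
  then have ker: "\<exists>a. \<forall>j. y $ j = a \<bullet> homogenize (p j)" if "stress_matrix w *v y = 0" for y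
    using stress_kernel_affine[OF stress_matrix_homogenize[OF E w] _ _ that] span_p[OF S0] by metis
  \<comment> \<open>The coordinates of \<open>q\<close> lie in the kernel of its own stress
    \<open>w\<close>, which by \<open>ker\<close> consists of affine functions of
    \<open>p\<close>.\<close>
  have "\<exists>a. \<forall>j. q j $ c = a \<bullet> homogenize (p j)" for c
    using ker[OF stress_matrix_homogenize[OF E wq, of "affine_form 0 (axis c 1)"]]
    by (simp add: inner_affine_form inner_axis')
  then obtain a where a: "\<And>c j. q j $ c = a c \<bullet> homogenize (p j)"
    by metis
  have "congruent_frameworks p q"
  proof (rule equivalent_affine_image_congruent[OF E w ker _ _ eq])
    show "q j = (\<chi> c. a c $ None) + (\<chi> c c'. a c $ Some c') *v p j" for j
      by (simp add: vec_eq_iff a inner_homogenize matrix_vector_mul_component)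
    show "\<exists>S. i \<in> S \<and> (\<forall>j\<in>S. j \<noteq> i \<longrightarrow> {i, j} \<in> E) \<and>
      (\<forall>v. (\<forall>j\<in>S. v \<bullet> homogenize (p j) = 0) \<longrightarrow> v = 0)" for i
    proof -
      have "k_connected (Suc CARD('d)) E"
        using assms(2) by simp
      then obtain S where S: "i \<in> S \<and> card S = Suc CARD('d) \<and> (\<forall>j\<in>S. j \<noteq> i \<longrightarrow> {i, j} \<in> E)"
        using k_connected_degree[OF E] by blast
      moreover have "\<forall>v. (\<forall>j\<in>S. v \<bullet> homogenize (p j) = 0) \<longrightarrow> v = 0"
        using span_p[of S] S by simp
      ultimately show ?thesis by blast
    qed
  qed
  with \<open>\<not> congruent_frameworks p q\<close> show False ..
qed

end
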